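(* Let $0<\alpha<1$, $0\le\theta\le1$, let $\Omega=(a,b)$, let $\kappa$ satisfy $c_0\le\kappa\le c_1$ on $\Omega$ for some positive constants $c_0,c_1$, and let $u$ satisfy $-\partial_x\big(\kappa\,\partial_x^{\alpha,\theta}u\big)=f$ on $\Omega$ with $u(a)=u(b)=0$. Assume that $f\in C^1(\overline\Omega)$, $\kappa\in C^2(\overline\Omega)$ and $u\in C^3(\overline\Omega)$. Define the truncation error, for $1\le n\le P-1$, by $$T_h^n=\partial_x\big(\kappa\,\partial_x^{\alpha,\theta}u\big)(x_n)-\frac1{h^2}\Big\{\kappa^{n+1/2}\Big[\theta\,\big({}_aI_x^{1-\alpha}\delta u\big)(x_{n+1})+(1-\theta)\,\big({}_xI_b^{1-\alpha}\delta u\big)(x_{n})\Big]-\kappa^{n-1/2}\Big[\theta\,\big({}_aI_x^{1-\alpha}\delta u\big)(x_n)+(1-\theta)\,\big({}_xI_b^{1-\alpha}\delta u\big)(x_{n-1})\Big]\Big\}.$$ Then $T_h^n=O(h)$ for $x_n$ not near the boundaries $x=a,b$; that is, for every fixed $\varepsilon>0$ there is a constant $C$, independent of $n$ and $h$, such that $|T_h^n|\le Ch$ whenever $a+\varepsilon\le x_n\le b-\varepsilon$.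
   Context: Uniform mesh: $P\ge 2$ is an integer, $h=(b-a)/P$, $x_n=a+nh$ for $0\le n\le P$, $I_n=(x_{n-1},x_n)$, $x_{n+1/2}=(x_n+x_{n+1})/2$, $\kappa^{n+1/2}=\kappa(x_{n+1/2})$, $u^n=u(x_n)$. The backward difference $\delta u$ is the piecewise constant function $\delta u(x)=\delta u^n:=u^n-u^{n-1}$ for $x\in I_n$. The left- and right-sided Riemann–Liouville fractional integrals are ${}_aI_x^{1-\alpha}v(x)=\int_a^x\omega_{1-\alpha}(x-z)v(z)\,dz$ and ${}_xI_b^{1-\alpha}v(x)=\int_x^b\omega_{1-\alpha}(z-x)v(z)\,dz$, with $\omega_{1-\alpha}(x)=x^{-\alpha}/\Gamma(1-\alpha)$. The fractional derivatives are ${}_aD_x^{\alpha}v=\partial_x\,{}_aI_x^{1-\alpha}v$ and ${}_xD_b^{\alpha}v=\partial_x\,{}_xI_b^{1-\alpha}v$ (no minus sign), and $\partial_x^{\alpha,\theta}v=\theta\,{}_aD_x^{\alpha}v+(1-\theta)\,{}_xD_b^{\alpha}v$. *)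

theory Defs
  imports "HOL-Analysis.Analysis"
begin

text \<open>
  \<open>k\<close> times continuously differentiable on \<open>S\<close>. Derivatives are taken within \<open>S\<close>, so on a
  compact interval they are one-sided at the end points, and no condition is imposed on the
  values of \<open>v\<close> outside \<open>S\<close>. The function \<open>D j\<close> is the \<open>j\<close>-th derivative.
\<close>
definition Ck_on :: "nat \<Rightarrow> real set \<Rightarrow> (real \<Rightarrow> real) \<Rightarrow> bool" where
  "Ck_on k S v \<longleftrightarrow> (\<exists>D :: nat \<Rightarrow> real \<Rightarrow> real.
      (\<forall>x\<in>S. D 0 x = v x) \<and>
      (\<forall>j<k. \<forall>x\<in>S. (D j has_real_derivative D (Suc j) x) (at x within S)) \<and>
      (\<forall>j\<le>k. continuous_on S (D j)))"

definition frac_kernel :: "real \<Rightarrow> real \<Rightarrow> real" where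
  "frac_kernel \<mu> x = x powr (\<mu> - 1) / Gamma \<mu>"

text \<open>
  Riemann--Liouville fractional integrals of order \<open>\<mu>\<close>; below they are used with
  \<open>\<mu> = 1 - \<alpha>\<close>. The value of the kernel at its singularity (where \<open>powr\<close> gives 0) only
  affects a null set.
\<close>
definition RL_int_left :: "real \<Rightarrow> real \<Rightarrow> (real \<Rightarrow> real) \<Rightarrow> real \<Rightarrow> real" where
  "RL_int_left \<mu> a v x = integral {a..x} (\<lambda>z. frac_kernel \<mu> (x - z) * v z)"

definition RL_int_right :: "real \<Rightarrow> real \<Rightarrow> (real \<Rightarrow> real) \<Rightarrow> real \<Rightarrow> real" where
  "RL_int_right \<mu> b v x = integral {x..b} (\<lambda>z. frac_kernel \<mu> (z - x) * v z)"

definition RL_deriv_left :: "real \<Rightarrow> real \<Rightarrow> (real \<Rightarrow> real) \<Rightarrow> real \<Rightarrow> real" where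
  "RL_deriv_left \<alpha> a v = deriv (RL_int_left (1 - \<alpha>) a v)"

text \<open>The right-sided derivative is used without the customary minus sign.\<close>
definition RL_deriv_right :: "real \<Rightarrow> real \<Rightarrow> (real \<Rightarrow> real) \<Rightarrow> real \<Rightarrow> real" where
  "RL_deriv_right \<alpha> b v = deriv (RL_int_right (1 - \<alpha>) b v)"

definition frac_deriv :: "real \<Rightarrow> real \<Rightarrow> real \<Rightarrow> real \<Rightarrow> (real \<Rightarrow> real) \<Rightarrow> real \<Rightarrow> real" where
  "frac_deriv \<alpha> \<theta> a b v x = \<theta> * RL_deriv_left \<alpha> a v x + (1 - \<theta>) * RL_deriv_right \<alpha> b v x"

definition mesh_size :: "real \<Rightarrow> real \<Rightarrow> nat \<Rightarrow> real" where
  "mesh_size a b P = (b - a) / real P"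

definition node :: "real \<Rightarrow> real \<Rightarrow> nat \<Rightarrow> nat \<Rightarrow> real" where
  "node a b P n = a + real n * mesh_size a b P"

text \<open>\<open>midpoint_node a b P n\<close> is $x_{n+1/2}$; hence $x_{n-1/2}$ has index \<open>n - 1\<close>.\<close>
definition midpoint_node :: "real \<Rightarrow> real \<Rightarrow> nat \<Rightarrow> nat \<Rightarrow> real" where
  "midpoint_node a b P n = (node a b P n + node a b P (n + 1)) / 2"

text \<open>
  The piecewise constant backward difference, with the value \<open>u(x\<^sub>n) - u(x\<^sub>n\<^sub>-\<^sub>1)\<close> on the open cell
  \<open>I\<^sub>n\<close>; at the nodes, a null set where it is not specified, it is 0.
\<close>
definition backward_diff ::
    "real \<Rightarrow> real \<Rightarrow> nat \<Rightarrow> (real \<Rightarrow> real) \<Rightarrow> real \<Rightarrow> real" where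
  "backward_diff a b P u x =
     (\<Sum>n = 1..P. (u (node a b P n) - u (node a b P (n - 1))) *
        indicator {node a b P (n - 1)<..<node a b P n} x)"

text \<open>Meaningful for \<open>1 \<le> n \<le> P - 1\<close> only.\<close>
definition truncation_error ::
    "real \<Rightarrow> real \<Rightarrow> real \<Rightarrow> real \<Rightarrow> (real \<Rightarrow> real) \<Rightarrow> (real \<Rightarrow> real) \<Rightarrow> nat \<Rightarrow> nat \<Rightarrow> real" where
  "truncation_error \<alpha> \<theta> a b \<kappa> u P n =
     deriv (\<lambda>x. \<kappa> x * frac_deriv \<alpha> \<theta> a b u x) (node a b P n) -
     1 / (mesh_size a b P)\<^sup>2 *
       (\<kappa> (midpoint_node a b P n) *
          (\<theta> * RL_int_left (1 - \<alpha>) a (backward_diff a b P u) (node a b P (n + 1)) +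
           (1 - \<theta>) * RL_int_right (1 - \<alpha>) b (backward_diff a b P u) (node a b P n)) -
        \<kappa> (midpoint_node a b P (n - 1)) *
          (\<theta> * RL_int_left (1 - \<alpha>) a (backward_diff a b P u) (node a b P n) +
           (1 - \<theta>) * RL_int_right (1 - \<alpha>) b (backward_diff a b P u) (node a b P (n - 1))))"

end

theory Submission
  imports Defs
begin

text \<open>
  Write \<open>\<mu> = 1 - \<alpha>\<close>, \<open>\<omega> s = s\<^sup>\<mu>\<^sup>-\<^sup>1 / \<Gamma>(\<mu>)\<close> for the kernel, and \<open>L v\<close>, \<open>R v\<close> for the left- and right-sided
  fractional integrals of order \<open>\<mu>\<close>; \<open>u1, u2, u3\<close> are the derivatives of \<open>u\<close>. For \<open>v\<close> of class
  \<open>C\<^sup>1\<close>, \<open>RL_int_left_has_derivative\<close> gives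

    \<open>(L v)'(x) = v(a) \<omega>(x - a) + (L v')(x)\<close>.

  As \<open>u(a) = 0\<close>, the left-sided fractional derivative of \<open>u\<close> is \<open>L u1\<close>, and its derivative is
  \<open>u1(a) \<omega>(x - a) + L u2\<close>.

  The discrete counterpart rests on the same mechanism, summation by parts in disguise. In
  the variable \<open>s\<close>, the distance to the singularity, \<open>L \<delta>u(x\<^sub>n) = \<integral> \<omega>(s) \<delta>u(x\<^sub>n - s) ds\<close> over
  \<open>{0..x\<^sub>n - a}\<close>. Hence the difference of \<open>L \<delta>u\<close> between \<open>x\<^sub>n\<^sub>+\<^sub>1\<close> and \<open>x\<^sub>n\<close> never differentiates the
  singular kernel: it is the integral of \<open>\<omega>\<close> against the second difference of \<open>u\<close>, plus the first increment
  \<open>u(a + h) - u(a)\<close> times the integral of \<open>\<omega>\<close> over one cell (\<open>RL_int_backward_diff_increment\<close>). The second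
  difference is \<open>h\<^sup>2 u2 + O(h\<^sup>3)\<close> uniformly because \<open>u3\<close> is bounded, and \<open>\<omega>\<close> is integrable. The
  boundary term is \<open>h\<^sup>2 u1(a) \<omega>(x\<^sub>n - a) + O(h\<^sup>3)\<close> as long as \<open>x\<^sub>n - a\<close> stays away from \<open>0\<close>, where \<open>\<omega>\<close> is
  Lipschitz; this is the role of \<open>\<epsilon>\<close>. So the increment is \<open>h\<^sup>2 (L u1)'(x\<^sub>n) + O(h\<^sup>3)\<close>
  (\<open>RL_int_backward_diff_increment_estimate\<close>), while \<open>L \<delta>u(x\<^sub>n) = h (L u1)(x\<^sub>n) + O(h\<^sup>2)\<close>
  (\<open>RL_int_backward_diff_estimate\<close>).

  A discrete product rule with the coefficient at the half-points combines both estimates into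
  \<open>h\<^sup>2 (\<kappa> L u1)'(x\<^sub>n) + O(h\<^sup>3)\<close> for the left-sided flux difference (\<open>left_flux_truncation\<close>). The
  reflection of the interval yields the right-sided one (\<open>right_flux_truncation\<close>), and the theorem is
  the convex combination of the two, divided by \<open>h\<^sup>2\<close>.
\<close>

section \<open>The weakly singular kernel\<close>

lemma frac_kernel_nonneg:
  assumes "0 < \<mu>"
  shows "0 \<le> frac_kernel \<mu> s"
  unfolding frac_kernel_def using Gamma_real_pos[OF assms] by simp

lemma has_integral_frac_kernel:
  assumes "0 < \<mu>" "0 \<le> c"
  shows "(frac_kernel \<mu> has_integral c powr \<mu> / (\<mu> * Gamma \<mu>)) {0..c}"
proof -
  have "((\<lambda>x. x powr (\<mu> - 1)) has_integral c powr \<mu> / \<mu>) {0..c}"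
    using has_integral_powr_from_0[of "\<mu> - 1" c] assms by simp
  from has_integral_divide[OF this, of "Gamma \<mu>"] show ?thesis
    by (simp add: frac_kernel_def[abs_def])
qed

lemma frac_kernel_integrable:
  assumes "0 < \<mu>" "0 \<le> c"
  shows "frac_kernel \<mu> integrable_on {0..c}"
  using has_integral_frac_kernel[OF assms] by (rule has_integral_integrable)

lemma frac_kernel_absolutely_integrable:
  assumes "0 < \<mu>" "0 \<le> c"
  shows "frac_kernel \<mu> absolutely_integrable_on {0..c}"
  using frac_kernel_integrable[OF assms] frac_kernel_nonneg[OF assms(1)]
  by (intro nonnegative_absolutely_integrable_1)

lemma frac_kernel_integral_mono:
  assumes "0 < \<mu>" "0 \<le> c" "c \<le> d"
  shows "integral {0..c} (frac_kernel \<mu>) \<le> integral {0..d} (frac_kernel \<mu>)"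
  using assms frac_kernel_nonneg[of \<mu>]
  by (intro integral_subset_le frac_kernel_integrable) auto

lemma frac_kernel_times_bounded_integrable:
  assumes "0 < \<mu>" "0 \<le> c"
    and "\<phi> \<in> borel_measurable (lebesgue_on {0..c})" "bounded (\<phi> ` {0..c})"
  shows "(\<lambda>s. frac_kernel \<mu> s * \<phi> s) integrable_on {0..c}"
proof -
  have "(\<lambda>s. \<phi> s * frac_kernel \<mu> s) absolutely_integrable_on {0..c}"
    using assms frac_kernel_absolutely_integrable
    by (intro absolutely_integrable_bounded_measurable_product_real) auto
  then show ?thesis
    by (simp add: mult.commute set_lebesgue_integral_eq_integral(1))
qed

lemma frac_kernel_times_continuous_integrable:
  assumes "0 < \<mu>" "0 \<le> c" and "continuous_on {0..c} \<phi>"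
  shows "(\<lambda>s. frac_kernel \<mu> s * \<phi> s) integrable_on {0..c}"
proof (rule frac_kernel_times_bounded_integrable[OF assms(1,2)])
  show "\<phi> \<in> borel_measurable (lebesgue_on {0..c})"
    using assms(3) by (intro continuous_imp_measurable_on_sets_lebesgue) auto
  show "bounded (\<phi> ` {0..c})"
    using assms(3) by (intro compact_imp_bounded compact_continuous_image) auto
qed

text \<open>
  The exceptional set absorbs the mesh points, where the backward difference takes an arbitrary
  value.
\<close>
lemma frac_kernel_integral_bound:
  assumes "0 < \<mu>" "0 \<le> c"
    and "(\<lambda>s. frac_kernel \<mu> s * \<phi> s) integrable_on {0..c}"
    and "negligible N" and "\<And>s. s \<in> {0..c} - N \<Longrightarrow> \<bar>\<phi> s\<bar> \<le> B"
  shows "\<bar>integral {0..c} (\<lambda>s. frac_kernel \<mu> s * \<phi> s)\<bar> \<le> B * integral {0..c} (frac_kernel \<mu>)"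
proof -
  define \<psi> where "\<psi> = (\<lambda>s. if s \<in> N then 0 else frac_kernel \<mu> s * \<phi> s)"
  have "\<psi> integrable_on {0..c}"
    by (rule integrable_spike[OF assms(3,4)]) (simp add: \<psi>_def)
  moreover have "(\<lambda>s. if s \<in> N then 0 else B * frac_kernel \<mu> s) integrable_on {0..c}"
    by (rule integrable_spike[OF _ assms(4), of "\<lambda>s. B * frac_kernel \<mu> s"])
      (auto intro!: integrable_on_mult_right frac_kernel_integrable assms)
  moreover have "norm (\<psi> s) \<le> (if s \<in> N then 0 else B * frac_kernel \<mu> s)" if "s \<in> {0..c}" for s
    using that assms(5)[of s] frac_kernel_nonneg[OF assms(1), of s]
    by (auto simp: \<psi>_def abs_mult mult.commute[of "frac_kernel \<mu> s"] intro: mult_right_mono)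
  ultimately have "norm (integral {0..c} \<psi>)
      \<le> integral {0..c} (\<lambda>s. if s \<in> N then 0 else B * frac_kernel \<mu> s)"
    by (rule Henstock_Kurzweil_Integration.integral_norm_bound_integral)
  moreover have "integral {0..c} \<psi> = integral {0..c} (\<lambda>s. frac_kernel \<mu> s * \<phi> s)"
    by (rule integral_spike[OF assms(4)]) (simp add: \<psi>_def)
  moreover have "integral {0..c} (\<lambda>s. if s \<in> N then 0 else B * frac_kernel \<mu> s)
      = integral {0..c} (\<lambda>s. B * frac_kernel \<mu> s)"
    by (rule integral_spike[OF assms(4)]) simp
  ultimately show ?thesis by simp
qed

lemma frac_kernel_has_derivative:
  assumes "0 < s"
  shows "(frac_kernel \<mu> has_real_derivative (\<mu> - 1) * s powr (\<mu> - 2) / Gamma \<mu>) (at s within S)"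
proof -
  have "((\<lambda>x. x powr (\<mu> - 1) / Gamma \<mu>) has_real_derivative
      ((\<mu> - 1) * s powr (\<mu> - 1 - 1)) / Gamma \<mu>) (at s)"
    using assms by (intro DERIV_cdivide has_real_derivative_powr)
  then show ?thesis
    by (auto simp: frac_kernel_def[abs_def] diff_diff_eq intro: has_field_derivative_at_within)
qed

lemma frac_kernel_antimono:
  assumes "0 < \<mu>" "\<mu> \<le> 1" "0 < s" "s \<le> t"
  shows "frac_kernel \<mu> t \<le> frac_kernel \<mu> s"
  unfolding frac_kernel_def using assms Gamma_real_pos[OF assms(1)]
  by (intro divide_right_mono powr_mono2') auto

lemma frac_kernel_lipschitz_away_from_0:
  assumes "0 < \<mu>" "\<mu> \<le> 1" "0 < \<epsilon>" "\<epsilon> \<le> s" "\<epsilon> \<le> t"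
  shows "\<bar>frac_kernel \<mu> s - frac_kernel \<mu> t\<bar> \<le> (1 - \<mu>) * \<epsilon> powr (\<mu> - 2) / Gamma \<mu> * \<bar>s - t\<bar>"
proof -
  have "norm (frac_kernel \<mu> s - frac_kernel \<mu> t) \<le> (1 - \<mu>) * \<epsilon> powr (\<mu> - 2) / Gamma \<mu> * norm (s - t)"
  proof (rule field_differentiable_bound[where S = "{\<epsilon>..}"])
    fix z assume "z \<in> {\<epsilon>..}"
    then have z: "\<epsilon> \<le> z" by simp
    then show "(frac_kernel \<mu> has_real_derivative (\<mu> - 1) * z powr (\<mu> - 2) / Gamma \<mu>) (at z within {\<epsilon>..})"
      using assms by (intro frac_kernel_has_derivative) auto
    have "z powr (\<mu> - 2) \<le> \<epsilon> powr (\<mu> - 2)"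
      using z assms by (intro powr_mono2') auto
    then show "norm ((\<mu> - 1) * z powr (\<mu> - 2) / Gamma \<mu>) \<le> (1 - \<mu>) * \<epsilon> powr (\<mu> - 2) / Gamma \<mu>"
      using assms Gamma_real_pos[OF assms(1)]
      by (auto simp: abs_mult intro!: divide_right_mono mult_left_mono)
  qed (use assms in auto)
  then show ?thesis by simp
qed

lemma continuous_on_Icc_bounded:
  fixes v :: "real \<Rightarrow> real"
  assumes "continuous_on {a..b} v"
  obtains M where "0 \<le> M" "\<And>y. y \<in> {a..b} \<Longrightarrow> \<bar>v y\<bar> \<le> M"
proof -
  have "bounded (v ` {a..b})"
    using assms by (intro compact_imp_bounded compact_continuous_image) auto
  then obtain M where "\<forall>y\<in>{a..b}. \<bar>v y\<bar> \<le> M"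
    by (auto simp: bounded_iff)
  then show thesis
    by (intro that[of "max 0 M"]) (auto simp: le_max_iff_disj)
qed

section \<open>Riemann--Liouville integrals as convolutions\<close>

lemma has_integral_reflect_shift:
  fixes f :: "real \<Rightarrow> real"
  assumes "(f has_integral i) {p..q}"
  shows "((\<lambda>s. f (x - s)) has_integral i) {x - q..x - p}"
proof -
  have "((\<lambda>s. f ((- 1) *\<^sub>R s + x)) has_integral (1 / \<bar>- 1 :: real\<bar> ^ DIM(real)) *\<^sub>R i)
      ((\<lambda>s. (1 / - 1) *\<^sub>R s + - ((1 / - 1) *\<^sub>R x)) ` cbox p q)"
    using assms by (intro has_integral_affinity) auto
  moreover have "(\<lambda>s. (1 / - 1) *\<^sub>R s + - ((1 / - 1) *\<^sub>R x)) ` cbox p q = {x - q..x - p}"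
    using image_diff_atLeastAtMost[of x p q] by simp
  ultimately show ?thesis by simp
qed

lemma integral_reflect_shift:
  fixes f :: "real \<Rightarrow> real"
  shows "integral {x - q..x - p} (\<lambda>s. f (x - s)) = integral {p..q} f"
proof -
  have "(f has_integral i) {p..q} \<longleftrightarrow> ((\<lambda>s. f (x - s)) has_integral i) {x - q..x - p}" for i
    using has_integral_reflect_shift[of f i p q x]
      has_integral_reflect_shift[of "\<lambda>s. f (x - s)" i "x - q" "x - p" x] by auto
  then show ?thesis
    unfolding integral_def integrable_on_def by simp
qed

lemma RL_int_left_convolution:
  "RL_int_left \<mu> a v x = integral {0..x - a} (\<lambda>s. frac_kernel \<mu> s * v (x - s))"
  unfolding RL_int_left_def
  using integral_reflect_shift[of x x a "\<lambda>z. frac_kernel \<mu> (x - z) * v z"] by simp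

text \<open>The reflection of the interval turns every left-sided result into a right-sided one.\<close>
lemma RL_int_right_reflect:
  "RL_int_right \<mu> b v x = RL_int_left \<mu> a (\<lambda>y. v (a + b - y)) (a + b - x)"
  unfolding RL_int_left_def RL_int_right_def
  using integral_reflect_shift[of "a + b" b x "\<lambda>z. frac_kernel \<mu> (z - x) * v z"]
  by (simp add: algebra_simps)

lemma RL_int_left_const:
  assumes "0 < \<mu>" "a \<le> x"
  shows "RL_int_left \<mu> a (\<lambda>y. c) x = c * (x - a) powr \<mu> / (\<mu> * Gamma \<mu>)"
  using has_integral_frac_kernel[OF assms(1), of "x - a"] assms
  by (simp add: RL_int_left_convolution integral_unique)

lemma continuous_on_reversed:
  fixes v :: "real \<Rightarrow> real"
  assumes "continuous_on {a..b} v" "x \<le> b" "c \<le> x - a"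
  shows "continuous_on {0..c} (\<lambda>s. v (x - s))"
  by (rule continuous_on_compose2[OF assms(1)]) (use assms in \<open>auto intro!: continuous_intros\<close>)

text \<open>
  Extended by zero to the left of \<open>a\<close>, \<open>v\<close> remains Lipschitz because \<open>v a = 0\<close>. The
  integral is then a convolution over the fixed interval \<open>{0..b - a}\<close> in which \<open>x\<close> enters only through
  the smooth factor, and the difference quotients are dominated by a multiple of the kernel.
\<close>
lemma RL_int_left_has_derivative_zero:
  fixes v v' :: "real \<Rightarrow> real"
  assumes \<mu>: "0 < \<mu>" and x: "x \<in> {a<..<b}"
    and v: "\<And>y. y \<in> {a..b} \<Longrightarrow> (v has_real_derivative v' y) (at y within {a..b})"
    and v': "continuous_on {a..b} v'" and va: "v a = 0"
  shows "(RL_int_left \<mu> a v has_real_derivative RL_int_left \<mu> a v' x) (at x)"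
proof -
  define w where "w = (\<lambda>y. if a \<le> y then v y else 0)"
  define w' where "w' = (\<lambda>y. if a \<le> y then v' y else 0)"
  define R where "R = b - a"
  have R: "0 \<le> R" using x by (simp add: R_def)
  have extend: "RL_int_left \<mu> a g y = integral {0..R} (\<lambda>s. frac_kernel \<mu> s * (if a \<le> y - s then g (y - s) else 0))"
    if "y \<in> {a<..<b}" for g y
  proof -
    have "integral {0..R} (\<lambda>s. frac_kernel \<mu> s * (if a \<le> y - s then g (y - s) else 0))
      = integral {0..R} (\<lambda>s. if s \<in> {0..y - a} then frac_kernel \<mu> s * g (y - s) else 0)"
      by (rule integral_cong) auto
    also have "\<dots> = integral ({0..y - a} \<inter> {0..R}) (\<lambda>s. frac_kernel \<mu> s * g (y - s))"
      by (rule Henstock_Kurzweil_Integration.integral_restrict_Int)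
    also have "{0..y - a} \<inter> {0..R} = {0..y - a}"
      using that by (auto simp: R_def)
    finally show ?thesis by (simp add: RL_int_left_convolution)
  qed
  obtain M where M: "\<And>y. y \<in> {a..b} \<Longrightarrow> \<bar>v' y\<bar> \<le> M"
    using continuous_on_Icc_bounded[OF v'] by blast
  have M0: "0 \<le> M" using M[of a] x by auto
  have v_lip: "\<bar>v y - v z\<bar> \<le> M * \<bar>y - z\<bar>" if "y \<in> {a..b}" "z \<in> {a..b}" for y z
    using field_differentiable_bound[of "{a..b}" v v' M y z] v M that by auto
  have w_lip: "\<bar>w y - w z\<bar> \<le> M * \<bar>y - z\<bar>" if "y \<le> b" "z \<le> b" for y z
  proof -
    have w_max: "w t = v (max a t)" if "t \<le> b" for t
      using va by (auto simp: w_def max_def)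
    have "\<bar>w y - w z\<bar> \<le> M * \<bar>max a y - max a z\<bar>"
      using v_lip[of "max a y" "max a z"] that x by (simp add: w_max)
    also have "\<dots> \<le> M * \<bar>y - z\<bar>"
      using M0 by (intro mult_left_mono) auto
    finally show ?thesis .
  qed
  have w_deriv: "(w has_real_derivative w' y) (at y)" if "y \<noteq> a" "y < b" for y
  proof (cases "a < y")
    case True
    then have "(v has_real_derivative v' y) (at y)"
      using v[of y] that at_within_Icc_at[of a y b] by auto
    then have "(w has_real_derivative v' y) (at y)"
      by (rule has_field_derivative_transform_within_open[where S = "{a<..}"])
        (use True in \<open>auto simp: w_def\<close>)
    with True show ?thesis by (simp add: w'_def)
  next
    case False
    have "(w has_real_derivative 0) (at y)"
      by (rule has_field_derivative_transform_within_open[where S = "{..<a}" and f = "\<lambda>_. 0"])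
        (use False that in \<open>auto simp: w_def\<close>)
    with False that show ?thesis by (simp add: w'_def)
  qed
  have w_int: "(\<lambda>s. frac_kernel \<mu> s * w (y - s)) integrable_on {0..R}" if "y \<in> {a<..<b}" for y
  proof (rule frac_kernel_times_continuous_integrable[OF \<mu> R])
    have "continuous_on {..b} w"
      using w_lip M0 by (intro lipschitz_on_continuous_on[of M] lipschitz_onI) (auto simp: dist_real_def)
    then show "continuous_on {0..R} (\<lambda>s. w (y - s))"
      by (rule continuous_on_compose2) (use that in \<open>auto intro!: continuous_intros\<close>)
  qed
  have "((\<lambda>y. (RL_int_left \<mu> a v y - RL_int_left \<mu> a v x) / (y - x)) \<longlongrightarrow> RL_int_left \<mu> a v' x)
      (at x within {a<..<b})"
    unfolding tendsto_at_iff_sequentially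
  proof (intro allI impI)
    fix X assume X: "\<forall>i. X i \<in> {a<..<b} - {x}" and lim: "X \<longlonglongrightarrow> x"
    define q where "q = (\<lambda>k s. (w (X k - s) - w (x - s)) / (X k - x))"
    \<comment> \<open>At the kink \<open>s = x - a\<close> the difference quotients need not converge.\<close>
    define F where "F = (\<lambda>k s. if s = x - a then 0 else frac_kernel \<mu> s * q k s)"
    define G where "G = (\<lambda>s. if s = x - a then 0 else frac_kernel \<mu> s * w' (x - s))"
    have q_int: "(\<lambda>s. frac_kernel \<mu> s * q k s) integrable_on {0..R}"
      and q_eq: "integral {0..R} (\<lambda>s. frac_kernel \<mu> s * q k s)
        = (RL_int_left \<mu> a v (X k) - RL_int_left \<mu> a v x) / (X k - x)" for k
    proof -
      have *: "((\<lambda>s. frac_kernel \<mu> s * w (y - s)) has_integral RL_int_left \<mu> a v y) {0..R}"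
        if "y \<in> {a<..<b}" for y
        using integrable_integral[OF w_int[OF that]] extend[OF that, of v] by (simp add: w_def)
      have "((\<lambda>s. (frac_kernel \<mu> s * w (X k - s) - frac_kernel \<mu> s * w (x - s)) / (X k - x)) has_integral
          (RL_int_left \<mu> a v (X k) - RL_int_left \<mu> a v x) / (X k - x)) {0..R}"
        using X x by (intro has_integral_divide has_integral_diff *) auto
      then have "((\<lambda>s. frac_kernel \<mu> s * q k s) has_integral
          (RL_int_left \<mu> a v (X k) - RL_int_left \<mu> a v x) / (X k - x)) {0..R}"
        by (simp add: q_def algebra_simps)
      then show "(\<lambda>s. frac_kernel \<mu> s * q k s) integrable_on {0..R}"
        and "integral {0..R} (\<lambda>s. frac_kernel \<mu> s * q k s)
        = (RL_int_left \<mu> a v (X k) - RL_int_left \<mu> a v x) / (X k - x)"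
        by (auto intro: has_integral_integrable integral_unique)
    qed
    have "(\<lambda>k. integral {0..R} (F k)) \<longlonglongrightarrow> integral {0..R} G"
    proof (rule dominated_convergence(2))
      show "F k integrable_on {0..R}" for k
        by (rule integrable_spike[OF q_int[of k] negligible_sing[of "x - a"]]) (simp add: F_def)
      show "(\<lambda>s. M * frac_kernel \<mu> s) integrable_on {0..R}"
        by (intro integrable_on_mult_right frac_kernel_integrable[OF \<mu> R])
      show "norm (F k s) \<le> M * frac_kernel \<mu> s" if "s \<in> {0..R}" for k s
      proof -
        have "\<bar>w (X k - s) - w (x - s)\<bar> \<le> M * \<bar>X k - x\<bar>"
          using w_lip[of "X k - s" "x - s"] that X[rule_format, of k] x by auto
        then have "\<bar>q k s\<bar> \<le> M"
          using X[rule_format, of k] by (simp add: q_def divide_le_eq)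
        then have "\<bar>frac_kernel \<mu> s * q k s\<bar> \<le> M * frac_kernel \<mu> s"
          using frac_kernel_nonneg[OF \<mu>, of s] by (simp add: abs_mult mult.commute[of "frac_kernel \<mu> s"] mult_right_mono)
        then show ?thesis
          using frac_kernel_nonneg[OF \<mu>, of s] M0 by (auto simp: F_def)
      qed
      show "(\<lambda>k. F k s) \<longlonglongrightarrow> G s" if "s \<in> {0..R}" for s
      proof (cases "s = x - a")
        case False
        have "((\<lambda>y. (w y - w (x - s)) / (y - (x - s))) \<longlongrightarrow> w' (x - s)) (at (x - s))"
          using w_deriv[of "x - s"] False that x by (auto simp: has_field_derivative_iff)
        moreover have "(\<lambda>k. X k - s) \<longlonglongrightarrow> x - s"
          using lim by (intro tendsto_intros)
        ultimately have "((\<lambda>y. (w y - w (x - s)) / (y - (x - s))) \<circ> (\<lambda>k. X k - s)) \<longlonglongrightarrow> w' (x - s)"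
          using X unfolding tendsto_at_iff_sequentially by auto
        then have "(\<lambda>k. frac_kernel \<mu> s * q k s) \<longlonglongrightarrow> frac_kernel \<mu> s * w' (x - s)"
          by (intro tendsto_mult_left) (simp add: q_def o_def)
        with False show ?thesis by (simp add: F_def G_def)
      qed (simp add: F_def G_def)
    qed
    moreover have "integral {0..R} (F k) = integral {0..R} (\<lambda>s. frac_kernel \<mu> s * q k s)" for k
      by (rule integral_spike[OF negligible_sing[of "x - a"]]) (simp add: F_def)
    moreover have "integral {0..R} G = integral {0..R} (\<lambda>s. frac_kernel \<mu> s * w' (x - s))"
      by (rule integral_spike[OF negligible_sing[of "x - a"]]) (simp add: G_def)
    moreover have "integral {0..R} (\<lambda>s. frac_kernel \<mu> s * w' (x - s)) = RL_int_left \<mu> a v' x"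
      using extend[OF x, of v'] by (simp add: w'_def)
    ultimately show "(((\<lambda>y. (RL_int_left \<mu> a v y - RL_int_left \<mu> a v x) / (y - x)) \<circ> X)
        \<longlonglongrightarrow> RL_int_left \<mu> a v' x)"
      by (simp add: q_eq o_def)
  qed
  then show ?thesis
    using x by (simp add: has_field_derivative_iff at_within_open[of x "{a<..<b}"])
qed

text \<open>
  Splitting off the constant \<open>v a\<close>, whose fractional integral is an explicit power of \<open>x - a\<close>, reduces
  to a function that vanishes at \<open>a\<close> and leaves the boundary term.
\<close>
lemma RL_int_left_has_derivative:
  fixes v v' :: "real \<Rightarrow> real"
  assumes \<mu>: "0 < \<mu>" and x: "x \<in> {a<..<b}"
    and v: "\<And>y. y \<in> {a..b} \<Longrightarrow> (v has_real_derivative v' y) (at y within {a..b})"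
    and v': "continuous_on {a..b} v'"
  shows "(RL_int_left \<mu> a v has_real_derivative
    v a * frac_kernel \<mu> (x - a) + RL_int_left \<mu> a v' x) (at x)"
proof -
  have cont: "continuous_on {a..b} v"
    using v by (rule DERIV_continuous_on)
  have "((\<lambda>y. (y - a) powr \<mu>) has_real_derivative (\<mu> * (x - a) powr (\<mu> - 1)) * 1) (at x)"
    using x by (intro DERIV_chain2[OF has_real_derivative_powr]) (auto intro!: derivative_eq_intros)
  from DERIV_cdivide[OF DERIV_cmult[OF this, of "v a"], of "\<mu> * Gamma \<mu>"]
  have "((\<lambda>y. v a * (y - a) powr \<mu> / (\<mu> * Gamma \<mu>)) has_real_derivative
      v a * frac_kernel \<mu> (x - a)) (at x)"
    using \<mu> by (simp add: frac_kernel_def)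
  moreover have "(RL_int_left \<mu> a (\<lambda>y. v y - v a) has_real_derivative RL_int_left \<mu> a v' x) (at x)"
  proof (rule RL_int_left_has_derivative_zero[OF \<mu> x _ v'])
    show "((\<lambda>y. v y - v a) has_real_derivative v' y) (at y within {a..b})" if "y \<in> {a..b}" for y
      using DERIV_diff[OF v[OF that] DERIV_const[of "v a"]] by simp
  qed simp
  ultimately have "((\<lambda>y. v a * (y - a) powr \<mu> / (\<mu> * Gamma \<mu>) + RL_int_left \<mu> a (\<lambda>y. v y - v a) y)
      has_real_derivative v a * frac_kernel \<mu> (x - a) + RL_int_left \<mu> a v' x) (at x)"
    by (rule DERIV_add)
  then show ?thesis
  proof (rule has_field_derivative_transform_within_open[where S = "{a<..<b}"])
    fix y assume y: "y \<in> {a<..<b}"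
    have "continuous_on {0..y - a} (\<lambda>s. v (y - s) - v a)"
      using y by (intro continuous_intros continuous_on_reversed[OF cont]) auto
    then have "RL_int_left \<mu> a (\<lambda>y. v a) y + RL_int_left \<mu> a (\<lambda>y. v y - v a) y
        = integral {0..y - a} (\<lambda>s. frac_kernel \<mu> s * v a + frac_kernel \<mu> s * (v (y - s) - v a))"
      unfolding RL_int_left_convolution using y
      by (intro Henstock_Kurzweil_Integration.integral_add[symmetric]
          frac_kernel_times_continuous_integrable[OF \<mu>]) auto
    also have "\<dots> = RL_int_left \<mu> a v y"
      unfolding RL_int_left_convolution by (simp add: algebra_simps)
    finally show "v a * (y - a) powr \<mu> / (\<mu> * Gamma \<mu>) + RL_int_left \<mu> a (\<lambda>y. v y - v a) y
        = RL_int_left \<mu> a v y"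
      using y by (simp add: RL_int_left_const[OF \<mu>])
  qed (use x in auto)
qed

lemma has_derivative_reflect:
  fixes v :: "real \<Rightarrow> real" and v' :: real
  assumes "(v has_real_derivative v') (at (a + b - y) within {a..b})"
  shows "((\<lambda>y. v (a + b - y)) has_real_derivative - v') (at y within {a..b})"
proof -
  have "(\<lambda>y. a + b - y) ` {a..b} = {a..b}"
    using image_diff_atLeastAtMost[of "a + b" a b] by simp
  then have "(v has_real_derivative v') (at (a + b - y) within (\<lambda>y. a + b - y) ` {a..b})"
    using assms by simp
  moreover have "((\<lambda>y. a + b - y) has_real_derivative - 1) (at y within {a..b})"
    by (auto intro!: derivative_eq_intros)
  ultimately show ?thesis
    using DERIV_image_chain[of v v' "\<lambda>y. a + b - y" y "{a..b}" "- 1"] by (simp add: o_def)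
qed

lemma continuous_on_reflect:
  fixes v :: "real \<Rightarrow> real"
  assumes "continuous_on {a..b} v"
  shows "continuous_on {a..b} (\<lambda>y. v (a + b - y))"
  by (rule continuous_on_compose2[OF assms]) (auto intro!: continuous_intros)

lemma RL_int_left_uminus: "RL_int_left \<mu> a (\<lambda>y. - v y) x = - RL_int_left \<mu> a v x"
  by (simp add: RL_int_left_def)

lemma RL_int_right_has_derivative:
  fixes v v' :: "real \<Rightarrow> real"
  assumes \<mu>: "0 < \<mu>" and x: "x \<in> {a<..<b}"
    and v: "\<And>y. y \<in> {a..b} \<Longrightarrow> (v has_real_derivative v' y) (at y within {a..b})"
    and v': "continuous_on {a..b} v'"
  shows "(RL_int_right \<mu> b v has_real_derivative
    - v b * frac_kernel \<mu> (b - x) + RL_int_right \<mu> b v' x) (at x)"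
proof -
  have "(RL_int_left \<mu> a (\<lambda>y. v (a + b - y)) has_real_derivative
      v (a + b - a) * frac_kernel \<mu> (a + b - x - a) + RL_int_left \<mu> a (\<lambda>y. - v' (a + b - y)) (a + b - x))
      (at (a + b - x))"
    using x by (intro RL_int_left_has_derivative[OF \<mu>, where b = b] has_derivative_reflect v
        continuous_on_minus continuous_on_reflect v') auto
  then have "((\<lambda>x. RL_int_left \<mu> a (\<lambda>y. v (a + b - y)) (a + b - x)) has_real_derivative
      (v b * frac_kernel \<mu> (b - x) - RL_int_right \<mu> b v' x) * - 1) (at x)"
    by (intro DERIV_chain2[where f = "RL_int_left \<mu> a (\<lambda>y. v (a + b - y))"])
      (auto intro!: derivative_eq_intros simp: RL_int_left_uminus RL_int_right_reflect[of \<mu> b v' x a])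
  then show ?thesis
    by (simp add: RL_int_right_reflect[of \<mu> b v _ a, abs_def])
qed

section \<open>Mesh and difference quotients\<close>

lemma mesh_size_pos: "a < b \<Longrightarrow> 0 < P \<Longrightarrow> 0 < mesh_size a b P"
  by (simp add: mesh_size_def)

lemma node_0 [simp]: "node a b P 0 = a"
  by (simp add: node_def)

lemma node_last: "0 < P \<Longrightarrow> node a b P P = b"
  by (simp add: node_def mesh_size_def)

lemma node_Suc: "node a b P (Suc n) = node a b P n + mesh_size a b P"
  by (simp add: node_def algebra_simps)

lemma node_pred: "1 \<le> n \<Longrightarrow> node a b P (n - 1) = node a b P n - mesh_size a b P"
  using node_Suc[of a b P "n - 1"] by simp

lemma node_mono: "a < b \<Longrightarrow> 0 < P \<Longrightarrow> m \<le> n \<Longrightarrow> node a b P m \<le> node a b P n"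
  using mesh_size_pos[of a b P] by (simp add: node_def mult_right_mono)

lemma node_in_interval: "a < b \<Longrightarrow> 0 < P \<Longrightarrow> n \<le> P \<Longrightarrow> node a b P n \<in> {a..b}"
  using node_mono[of a b P 0 n] node_mono[of a b P n P] node_last[of P a b] by simp

lemma node_reflect:
  assumes "0 < P" "n \<le> P"
  shows "node a b P (P - n) = a + b - node a b P n"
proof -
  have "real P * mesh_size a b P = b - a"
    using assms by (simp add: mesh_size_def)
  then show ?thesis
    using assms by (simp add: node_def of_nat_diff algebra_simps)
qed

lemma midpoint_node_eq: "midpoint_node a b P n = node a b P n + mesh_size a b P / 2"
  by (simp add: midpoint_node_def node_Suc field_simps)

lemma backward_diff_on_cell:
  assumes "a < b" "j \<in> {1..P}" and y: "y \<in> {node a b P (j - 1)<..<node a b P j}"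
  shows "backward_diff a b P u y = u (node a b P j) - u (node a b P (j - 1))"
proof -
  have "indicator {node a b P (n - 1)<..<node a b P n} y = (if n = j then 1 else 0 :: real)"
    if n: "n \<in> {1..P}" for n
  proof (cases n j rule: linorder_cases)
    case less
    then have "node a b P n \<le> node a b P (j - 1)"
      using assms by (intro node_mono) auto
    with less y show ?thesis by auto
  next
    case greater
    then have "node a b P j \<le> node a b P (n - 1)"
      using assms by (intro node_mono) auto
    with greater y show ?thesis by auto
  qed (use y in auto)
  then have "backward_diff a b P u y
      = (\<Sum>n = 1..P. if n = j then u (node a b P j) - u (node a b P (j - 1)) else 0)"
    unfolding backward_diff_def by (intro sum.cong) auto
  then show ?thesis using assms by simp
qed

lemma cell_exists:
  assumes "a < b" "0 < P" "y \<in> {a..b}" "y \<notin> node a b P ` {..P}"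
  obtains j where "j \<in> {1..P}" "y \<in> {node a b P (j - 1)<..<node a b P j}"
proof -
  define j where "j = (LEAST j. y < node a b P j)"
  have P: "y < node a b P P"
    using assms node_last[of P a b] by (metis atLeastAtMost_iff atMost_iff image_eqI order_le_imp_less_or_eq order_refl)
  then have j: "y < node a b P j"
    unfolding j_def by (rule LeastI)
  have "j \<le> P"
    unfolding j_def using P by (rule Least_le)
  have "j \<noteq> 0"
    using j assms by (metis atLeastAtMost_iff node_0 not_less)
  then have "\<not> y < node a b P (j - 1)"
    using not_less_Least[of "j - 1" "\<lambda>j. y < node a b P j"] by (simp add: j_def)
  moreover have "y \<noteq> node a b P (j - 1)"
    using assms \<open>j \<le> P\<close> by auto
  ultimately show thesis
    using that[of j] j \<open>j \<le> P\<close> \<open>j \<noteq> 0\<close> by auto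
qed

lemma frac_kernel_backward_diff_integrable:
  assumes "0 < \<mu>" "0 \<le> c"
  shows "(\<lambda>s. frac_kernel \<mu> s * backward_diff a b P u (x - s)) integrable_on {0..c}"
proof (rule frac_kernel_times_bounded_integrable[OF assms])
  have "(\<lambda>s. backward_diff a b P u (x - s)) \<in> borel_measurable borel"
    unfolding backward_diff_def by measurable
  then have "(\<lambda>s. backward_diff a b P u (x - s)) \<in> borel_measurable lebesgue"
    by (simp add: measurable_completion)
  then show "(\<lambda>s. backward_diff a b P u (x - s)) \<in> borel_measurable (lebesgue_on {0..c})"
    by (rule measurable_restrict_space1)
  have "\<bar>backward_diff a b P u y\<bar> \<le> (\<Sum>n = 1..P. \<bar>u (node a b P n) - u (node a b P (n - 1))\<bar>)" for y
    unfolding backward_diff_def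
    by (rule order_trans[OF sum_abs], rule sum_mono) (simp add: abs_mult indicator_def)
  then show "bounded ((\<lambda>s. backward_diff a b P u (x - s)) ` {0..c})"
    by (auto simp: bounded_iff)
qed

lemma backward_diff_reflect:
  assumes "0 < P"
  shows "backward_diff a b P u (a + b - y) = - backward_diff a b P (\<lambda>z. u (a + b - z)) y"
proof -
  define t where "t = (\<lambda>n. (u (node a b P n) - u (node a b P (n - 1))) *
      indicator {node a b P (n - 1)<..<node a b P n} (a + b - y))"
  have "backward_diff a b P u (a + b - y) = (\<Sum>n = 1..P. t n)"
    by (simp add: backward_diff_def t_def)
  also have "\<dots> = (\<Sum>n = 1..P. t (P + 1 - n))"
    using sum.atLeastAtMost_rev[of t 1 P] by simp
  also have "\<dots> = (\<Sum>n = 1..P. - ((u (a + b - node a b P n) - u (a + b - node a b P (n - 1))) *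
      indicator {node a b P (n - 1)<..<node a b P n} y))"
  proof (rule sum.cong)
    fix n assume n: "n \<in> {1..P}"
    have eq: "P + 1 - n = P - (n - 1)" "P + 1 - n - 1 = P - n"
      using n by auto
    have "node a b P (P + 1 - n) = a + b - node a b P (n - 1)"
      unfolding eq(1) using n by (intro node_reflect assms) auto
    moreover have "node a b P (P + 1 - n - 1) = a + b - node a b P n"
      unfolding eq(2) using n by (intro node_reflect assms) auto
    ultimately show "t (P + 1 - n) = - ((u (a + b - node a b P n) - u (a + b - node a b P (n - 1))) *
      indicator {node a b P (n - 1)<..<node a b P n} y)"
      unfolding t_def by (auto simp: indicator_def)
  qed simp
  finally show ?thesis by (simp add: backward_diff_def sum_negf)
qed

lemma mean_value_Icc:
  fixes v v' :: "real \<Rightarrow> real"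
  assumes "\<And>y. y \<in> {a..b} \<Longrightarrow> (v has_real_derivative v' y) (at y within {a..b})"
    and "a \<le> p" "p < q" "q \<le> b"
  obtains \<xi> where "p < \<xi>" "\<xi> < q" "v q - v p = v' \<xi> * (q - p)"
proof -
  have "\<exists>x\<in>{p<..<q}. v q - v p = (\<lambda>z. v' x * z) (q - p)"
  proof (rule mvt_simple[OF assms(3), where f' = "\<lambda>x z. v' x * z"])
    fix x assume "p \<le> x" "x \<le> q"
    then have "(v has_real_derivative v' x) (at x within {p..q})"
      using assms by (intro DERIV_subset[OF assms(1)]) auto
    then show "(v has_derivative (\<lambda>z. v' x * z)) (at x within {p..q})"
      by (simp add: has_field_derivative_def)
  qed
  then show thesis using that by auto
qed

lemma derivative_bound_lipschitz:
  fixes v v' :: "real \<Rightarrow> real"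
  assumes "\<And>y. y \<in> {a..b} \<Longrightarrow> (v has_real_derivative v' y) (at y within {a..b})"
    and "\<And>y. y \<in> {a..b} \<Longrightarrow> \<bar>v' y\<bar> \<le> M" and "y \<in> {a..b}" "z \<in> {a..b}"
  shows "\<bar>v y - v z\<bar> \<le> M * \<bar>y - z\<bar>"
  using field_differentiable_bound[of "{a..b}" v v' M y z] assms by auto

lemma first_difference_estimate:
  fixes v v' v'' :: "real \<Rightarrow> real"
  assumes v: "\<And>y. y \<in> {a..b} \<Longrightarrow> (v has_real_derivative v' y) (at y within {a..b})"
    and v': "\<And>y. y \<in> {a..b} \<Longrightarrow> (v' has_real_derivative v'' y) (at y within {a..b})"
    and M: "\<And>y. y \<in> {a..b} \<Longrightarrow> \<bar>v'' y\<bar> \<le> M"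
    and "0 < h" "a \<le> p" "p + h \<le> b" "y \<in> {p..p + h}"
  shows "\<bar>v (p + h) - v p - h * v' y\<bar> \<le> M * h\<^sup>2"
proof -
  have M0: "0 \<le> M" using M[of p] assms(4-6) by auto
  obtain \<xi> where \<xi>: "p < \<xi>" "\<xi> < p + h" "v (p + h) - v p = v' \<xi> * (p + h - p)"
    by (rule mean_value_Icc[OF v, of p "p + h"]) (use assms in auto)
  have "\<bar>v' \<xi> - v' y\<bar> \<le> M * \<bar>\<xi> - y\<bar>"
    by (rule derivative_bound_lipschitz[OF v' M]) (use assms \<xi> in auto)
  also have "\<dots> \<le> M * h"
    using \<xi> assms M0 by (intro mult_left_mono) auto
  finally have "h * \<bar>v' \<xi> - v' y\<bar> \<le> h * (M * h)"
    using assms by (intro mult_left_mono) auto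
  moreover have "v (p + h) - v p - h * v' y = h * (v' \<xi> - v' y)"
    using \<xi> by (simp add: algebra_simps)
  ultimately show ?thesis
    using assms by (simp add: abs_mult power2_eq_square mult_ac)
qed

text \<open>
  The comparison point \<open>y\<close> may lie anywhere in the left cell: only first order is claimed, so the
  symmetry of the second difference is not exploited.
\<close>
lemma second_difference_estimate:
  fixes v v' v'' v''' :: "real \<Rightarrow> real"
  assumes v: "\<And>y. y \<in> {a..b} \<Longrightarrow> (v has_real_derivative v' y) (at y within {a..b})"
    and v': "\<And>y. y \<in> {a..b} \<Longrightarrow> (v' has_real_derivative v'' y) (at y within {a..b})"
    and v'': "\<And>y. y \<in> {a..b} \<Longrightarrow> (v'' has_real_derivative v''' y) (at y within {a..b})"
    and M: "\<And>y. y \<in> {a..b} \<Longrightarrow> \<bar>v''' y\<bar> \<le> M"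
    and h: "0 < h" "a \<le> p - h" "p + h \<le> b" "y \<in> {p - h..p}"
  shows "\<bar>(v (p + h) - v p) - (v p - v (p - h)) - h\<^sup>2 * v'' y\<bar> \<le> 2 * M * h ^ 3"
proof -
  have M0: "0 \<le> M" using M[of p] h by auto
  define w where "w = (\<lambda>y. v (y + h) - v y)"
  obtain \<xi> where \<xi>: "p - h < \<xi>" "\<xi> < p" "w p - w (p - h) = (v' (\<xi> + h) - v' \<xi>) * (p - (p - h))"
  proof (rule mean_value_Icc[of "p - h" p w "\<lambda>y. v' (y + h) - v' y" "p - h" p])
    fix y assume y: "y \<in> {p - h..p}"
    have "(\<lambda>y. y + h) ` {p - h..p} \<subseteq> {a..b}" using h by auto
    then have "(v has_real_derivative v' (y + h)) (at (y + h) within (\<lambda>y. y + h) ` {p - h..p})"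
      using y h by (intro DERIV_subset[OF v]) auto
    moreover have "((\<lambda>y. y + h) has_real_derivative 1) (at y within {p - h..p})"
      by (auto intro!: derivative_eq_intros)
    ultimately have "(v \<circ> (\<lambda>y. y + h) has_real_derivative v' (y + h) * 1) (at y within {p - h..p})"
      by (rule DERIV_image_chain)
    then have "((\<lambda>y. v (y + h)) has_real_derivative v' (y + h)) (at y within {p - h..p})"
      by (simp add: o_def)
    moreover have "(v has_real_derivative v' y) (at y within {p - h..p})"
      using y h by (intro DERIV_subset[OF v]) auto
    ultimately show "(w has_real_derivative v' (y + h) - v' y) (at y within {p - h..p})"
      unfolding w_def by (auto intro: DERIV_diff)
  qed (use h in auto)
  obtain \<eta> where \<eta>: "\<xi> < \<eta>" "\<eta> < \<xi> + h" "v' (\<xi> + h) - v' \<xi> = v'' \<eta> * (\<xi> + h - \<xi>)"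
    by (rule mean_value_Icc[OF v', of \<xi> "\<xi> + h"]) (use h \<xi> in auto)
  have "\<bar>v'' \<eta> - v'' y\<bar> \<le> M * \<bar>\<eta> - y\<bar>"
    by (rule derivative_bound_lipschitz[OF v'' M]) (use h \<xi> \<eta> in auto)
  also have "\<dots> \<le> M * (2 * h)"
    using \<xi> \<eta> h M0 by (intro mult_left_mono) auto
  finally have "h\<^sup>2 * \<bar>v'' \<eta> - v'' y\<bar> \<le> h\<^sup>2 * (M * (2 * h))"
    by (intro mult_left_mono) auto
  moreover have "(v (p + h) - v p) - (v p - v (p - h)) - h\<^sup>2 * v'' y = h\<^sup>2 * (v'' \<eta> - v'' y)"
    using \<xi> \<eta> by (simp add: w_def algebra_simps power2_eq_square)
  ultimately show ?thesis
    by (simp add: abs_mult power2_eq_square power3_eq_cube mult_ac)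
qed

section \<open>Consistency of the discrete fractional integral\<close>

lemma RL_int_left_bound:
  assumes "0 < \<mu>" "x \<in> {a..b}" "continuous_on {a..b} v" "\<And>y. y \<in> {a..b} \<Longrightarrow> \<bar>v y\<bar> \<le> M"
  shows "\<bar>RL_int_left \<mu> a v x\<bar> \<le> M * integral {0..b - a} (frac_kernel \<mu>)"
proof -
  have "0 \<le> M" using assms(4)[OF assms(2)] by simp
  have "\<bar>RL_int_left \<mu> a v x\<bar> \<le> M * integral {0..x - a} (frac_kernel \<mu>)"
    unfolding RL_int_left_convolution using assms
    by (intro frac_kernel_integral_bound[where N = "{}"] frac_kernel_times_continuous_integrable
        continuous_on_reversed[OF assms(3)]) auto
  also have "\<dots> \<le> M * integral {0..b - a} (frac_kernel \<mu>)"
    using assms \<open>0 \<le> M\<close> by (intro mult_left_mono frac_kernel_integral_mono) auto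
  finally show ?thesis .
qed

lemma negligible_reversed_nodes: "negligible ((\<lambda>j. x - node a b P j) ` {..P})"
  by (intro negligible_finite) simp

lemma reversed_cell_exists:
  assumes "a < b" "0 < P" "s \<in> {0..x - a} - (\<lambda>j. x - node a b P j) ` {..P}" "x \<in> {a..b}"
  obtains j where "j \<in> {1..P}" "x - s \<in> {node a b P (j - 1)<..<node a b P j}"
proof (rule cell_exists[OF assms(1,2)])
  show "x - s \<in> {a..b}" using assms by auto
  show "x - s \<notin> node a b P ` {..P}"
  proof
    assume "x - s \<in> node a b P ` {..P}"
    then obtain j where "j \<in> {..P}" "x - s = node a b P j" by auto
    then have "s = x - node a b P j" by simp
    with assms(3) \<open>j \<in> {..P}\<close> show False by auto
  qed
qed

lemma RL_int_backward_diff_estimate: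
  fixes u u1 u2 :: "real \<Rightarrow> real"
  assumes \<mu>: "0 < \<mu>" and ab: "a < b"
    and u: "\<And>y. y \<in> {a..b} \<Longrightarrow> (u has_real_derivative u1 y) (at y within {a..b})"
    and u1: "\<And>y. y \<in> {a..b} \<Longrightarrow> (u1 has_real_derivative u2 y) (at y within {a..b})"
    and M2: "\<And>y. y \<in> {a..b} \<Longrightarrow> \<bar>u2 y\<bar> \<le> M2"
    and P: "0 < P" "n \<le> P"
  shows "\<bar>RL_int_left \<mu> a (backward_diff a b P u) (node a b P n)
      - mesh_size a b P * RL_int_left \<mu> a u1 (node a b P n)\<bar>
    \<le> M2 * integral {0..b - a} (frac_kernel \<mu>) * (mesh_size a b P)\<^sup>2"
proof -
  define h x where "h = mesh_size a b P" and "x = node a b P n"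
  have h: "0 < h" and x: "x \<in> {a..b}"
    using mesh_size_pos node_in_interval ab P by (auto simp: h_def x_def)
  have M0: "0 \<le> M2" using M2[OF x] by simp
  have "continuous_on {a..b} u1"
    using u1 by (rule DERIV_continuous_on)
  then have u1_int: "(\<lambda>s. frac_kernel \<mu> s * u1 (x - s)) integrable_on {0..x - a}"
    using x by (intro frac_kernel_times_continuous_integrable[OF \<mu>] continuous_on_reversed) auto
  have "((\<lambda>s. frac_kernel \<mu> s * backward_diff a b P u (x - s) - h * (frac_kernel \<mu> s * u1 (x - s)))
      has_integral RL_int_left \<mu> a (backward_diff a b P u) x - h * RL_int_left \<mu> a u1 x) {0..x - a}"
    unfolding RL_int_left_convolution using x
    by (intro has_integral_diff has_integral_mult_right integrable_integral u1_int
        frac_kernel_backward_diff_integrable[OF \<mu>]) auto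
  then have *: "((\<lambda>s. frac_kernel \<mu> s * (backward_diff a b P u (x - s) - h * u1 (x - s)))
      has_integral RL_int_left \<mu> a (backward_diff a b P u) x - h * RL_int_left \<mu> a u1 x) {0..x - a}"
    by (simp add: algebra_simps)
  have "\<bar>integral {0..x - a} (\<lambda>s. frac_kernel \<mu> s * (backward_diff a b P u (x - s) - h * u1 (x - s)))\<bar>
      \<le> (M2 * h\<^sup>2) * integral {0..x - a} (frac_kernel \<mu>)"
  proof (rule frac_kernel_integral_bound[OF \<mu> _ has_integral_integrable[OF *] negligible_reversed_nodes])
    fix s assume s: "s \<in> {0..x - a} - (\<lambda>j. x - node a b P j) ` {..P}"
    define y where "y = x - s"
    obtain j where j: "j \<in> {1..P}" "y \<in> {node a b P (j - 1)<..<node a b P j}"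
      unfolding y_def using s x by (elim reversed_cell_exists[OF ab P(1)]) auto
    have p: "node a b P j = node a b P (j - 1) + h"
      using node_Suc[of a b P "j - 1"] j by (simp add: h_def)
    have "\<bar>u (node a b P (j - 1) + h) - u (node a b P (j - 1)) - h * u1 y\<bar> \<le> M2 * h\<^sup>2"
      by (rule first_difference_estimate[OF u u1 M2 h])
        (use j p node_in_interval[OF ab P(1), of j] node_in_interval[OF ab P(1), of "j - 1"] in auto)
    then show "\<bar>backward_diff a b P u (x - s) - h * u1 (x - s)\<bar> \<le> M2 * h\<^sup>2"
      using backward_diff_on_cell[OF ab j, of u] p by (simp add: y_def)
  qed (use x in auto)
  also have "\<dots> \<le> (M2 * h\<^sup>2) * integral {0..b - a} (frac_kernel \<mu>)"
    using x M0 by (intro mult_left_mono frac_kernel_integral_mono \<mu>) auto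
  finally show ?thesis
    using integral_unique[OF *] by (simp add: h_def x_def mult_ac)
qed

text \<open>
  Both integrals are written in the variable \<open>s = x - z\<close>, the distance to the singularity, so the
  singular parts of the kernel coincide and the difference falls on \<open>\<delta>u\<close> instead: the singularity
  is integrated against a second difference. What remains is the kernel over a single cell at distance
  \<open>x\<^sub>n - a\<close> from the singularity.
\<close>
lemma RL_int_backward_diff_increment:
  assumes \<mu>: "0 < \<mu>" and ab: "a < b" and n: "n < P"
  defines "x \<equiv> node a b P n" and "h \<equiv> mesh_size a b P"
  shows "RL_int_left \<mu> a (backward_diff a b P u) (x + h) - RL_int_left \<mu> a (backward_diff a b P u) x
    = integral {0..x - a} (\<lambda>s. frac_kernel \<mu> s *
        (backward_diff a b P u (x + h - s) - backward_diff a b P u (x - s)))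
      + (u (a + h) - u a) * integral {x - a..x + h - a} (frac_kernel \<mu>)"
proof -
  let ?d = "backward_diff a b P u"
  have P: "0 < P" using n by simp
  have h: "0 < h" and x: "a \<le> x"
    using mesh_size_pos[OF ab P] node_in_interval[OF ab P, of n] n by (auto simp: h_def x_def)
  have "RL_int_left \<mu> a ?d (x + h)
      = integral {0..x - a} (\<lambda>s. frac_kernel \<mu> s * ?d (x + h - s))
        + integral {x - a..x + h - a} (\<lambda>s. frac_kernel \<mu> s * ?d (x + h - s))"
    unfolding RL_int_left_convolution using h x
    by (intro Henstock_Kurzweil_Integration.integral_combine[symmetric]
        frac_kernel_backward_diff_integrable[OF \<mu>]) auto
  moreover have "integral {x - a..x + h - a} (\<lambda>s. frac_kernel \<mu> s * ?d (x + h - s))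
      = integral {x - a..x + h - a} (\<lambda>s. (u (a + h) - u a) * frac_kernel \<mu> s)"
  proof (rule integral_spike[of "{x - a, x + h - a}"])
    fix s assume "s \<in> {x - a..x + h - a} - {x - a, x + h - a}"
    then have "x + h - s \<in> {node a b P (1 - 1)<..<node a b P 1}"
      using node_Suc[of a b P 0] by (auto simp: h_def)
    then show "(u (a + h) - u a) * frac_kernel \<mu> s = frac_kernel \<mu> s * ?d (x + h - s)"
      using backward_diff_on_cell[OF ab, of 1 P "x + h - s" u] P node_Suc[of a b P 0]
      by (simp add: h_def)
  qed simp
  moreover have "integral {0..x - a} (\<lambda>s. frac_kernel \<mu> s * (?d (x + h - s) - ?d (x - s)))
      = integral {0..x - a} (\<lambda>s. frac_kernel \<mu> s * ?d (x + h - s)) - RL_int_left \<mu> a ?d x"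
    unfolding RL_int_left_convolution right_diff_distrib using x
    by (intro Henstock_Kurzweil_Integration.integral_diff
        frac_kernel_backward_diff_integrable[OF \<mu>]) auto
  ultimately show ?thesis by simp
qed

text \<open>
  The limit is the derivative of \<open>RL_int_left \<mu> a u1\<close>: its integral part comes from the second
  differences, its boundary term from the extra cell. Only the latter needs the kernel to be
  Lipschitz, hence the distance \<open>\<epsilon>\<close> from \<open>a\<close>.
\<close>
lemma RL_int_backward_diff_increment_estimate:
  fixes u u1 u2 u3 :: "real \<Rightarrow> real"
  assumes \<mu>: "0 < \<mu>" "\<mu> \<le> 1" and ab: "a < b" and \<epsilon>: "0 < \<epsilon>"
    and u: "\<And>y. y \<in> {a..b} \<Longrightarrow> (u has_real_derivative u1 y) (at y within {a..b})"
    and u1: "\<And>y. y \<in> {a..b} \<Longrightarrow> (u1 has_real_derivative u2 y) (at y within {a..b})"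
    and u2: "\<And>y. y \<in> {a..b} \<Longrightarrow> (u2 has_real_derivative u3 y) (at y within {a..b})"
    and M1: "\<And>y. y \<in> {a..b} \<Longrightarrow> \<bar>u1 y\<bar> \<le> M1"
    and M2: "\<And>y. y \<in> {a..b} \<Longrightarrow> \<bar>u2 y\<bar> \<le> M2"
    and M3: "\<And>y. y \<in> {a..b} \<Longrightarrow> \<bar>u3 y\<bar> \<le> M3"
    and n: "n < P"
  defines "x \<equiv> node a b P n" and "h \<equiv> mesh_size a b P"
  assumes x\<epsilon>: "a + \<epsilon> \<le> x"
  shows "\<bar>RL_int_left \<mu> a (backward_diff a b P u) (x + h) - RL_int_left \<mu> a (backward_diff a b P u) x
      - h\<^sup>2 * (u1 a * frac_kernel \<mu> (x - a) + RL_int_left \<mu> a u2 x)\<bar>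
    \<le> (2 * M3 * integral {0..b - a} (frac_kernel \<mu>)
        + M1 * ((1 - \<mu>) * \<epsilon> powr (\<mu> - 2) / Gamma \<mu>) + M2 * frac_kernel \<mu> \<epsilon>) * h ^ 3"
proof -
  let ?d = "backward_diff a b P u"
  have P: "0 < P" using n by simp
  have h: "0 < h" and x: "x \<in> {a..b}"
    using mesh_size_pos[OF ab P] node_in_interval[OF ab P, of n] n by (auto simp: h_def x_def)
  have xh: "x + h \<le> b"
    using node_in_interval[OF ab P, of "Suc n"] n by (simp add: x_def h_def node_Suc)
  have M1_0: "0 \<le> M1" and M3_0: "0 \<le> M3" using M1[OF x] M3[OF x] by auto
  define K where "K = (1 - \<mu>) * \<epsilon> powr (\<mu> - 2) / Gamma \<mu>"
  have K0: "0 \<le> K" using \<mu> Gamma_real_pos[OF \<mu>(1)] by (simp add: K_def)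
  define I where "I = integral {0..x - a} (\<lambda>s. frac_kernel \<mu> s * (?d (x + h - s) - ?d (x - s)))"
  define w where "w = integral {x - a..x + h - a} (frac_kernel \<mu>)"
  have incr: "RL_int_left \<mu> a ?d (x + h) - RL_int_left \<mu> a ?d x = I + (u (a + h) - u a) * w"
    unfolding I_def w_def x_def h_def by (rule RL_int_backward_diff_increment[OF \<mu>(1) ab n])

  have "\<bar>I - h\<^sup>2 * RL_int_left \<mu> a u2 x\<bar> \<le> 2 * M3 * h ^ 3 * integral {0..b - a} (frac_kernel \<mu>)"
  proof -
    have "continuous_on {a..b} u2"
      using u2 by (rule DERIV_continuous_on)
    then have u2_int: "(\<lambda>s. frac_kernel \<mu> s * u2 (x - s)) integrable_on {0..x - a}"
      using x by (intro frac_kernel_times_continuous_integrable[OF \<mu>(1)] continuous_on_reversed) auto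
    have d_int: "(\<lambda>s. frac_kernel \<mu> s * (?d (x + h - s) - ?d (x - s))) integrable_on {0..x - a}"
      unfolding right_diff_distrib using x
      by (intro integrable_diff frac_kernel_backward_diff_integrable[OF \<mu>(1)]) auto
    have "((\<lambda>s. frac_kernel \<mu> s * (?d (x + h - s) - ?d (x - s)) - h\<^sup>2 * (frac_kernel \<mu> s * u2 (x - s)))
        has_integral I - h\<^sup>2 * RL_int_left \<mu> a u2 x) {0..x - a}"
      unfolding RL_int_left_convolution I_def
      by (intro has_integral_diff has_integral_mult_right integrable_integral u2_int d_int)
    then have *: "((\<lambda>s. frac_kernel \<mu> s * (?d (x + h - s) - ?d (x - s) - h\<^sup>2 * u2 (x - s)))
        has_integral I - h\<^sup>2 * RL_int_left \<mu> a u2 x) {0..x - a}"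
      by (simp add: algebra_simps)
    have "\<bar>integral {0..x - a} (\<lambda>s. frac_kernel \<mu> s * (?d (x + h - s) - ?d (x - s) - h\<^sup>2 * u2 (x - s)))\<bar>
        \<le> (2 * M3 * h ^ 3) * integral {0..x - a} (frac_kernel \<mu>)"
    proof (rule frac_kernel_integral_bound[OF \<mu>(1) _ has_integral_integrable[OF *] negligible_reversed_nodes])
      fix s assume s: "s \<in> {0..x - a} - (\<lambda>j. x - node a b P j) ` {..P}"
      define y where "y = x - s"
      obtain j where j: "j \<in> {1..P}" "y \<in> {node a b P (j - 1)<..<node a b P j}"
        unfolding y_def using s x by (elim reversed_cell_exists[OF ab P]) auto
      \<comment> \<open>Since \<open>y \<le> x\<^sub>n\<close> and \<open>n < P\<close>, the cell of \<open>y\<close> has a right neighbour.\<close>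
      have "j \<le> n"
      proof (rule ccontr)
        assume "\<not> j \<le> n"
        then have "x \<le> node a b P (j - 1)"
          unfolding x_def using ab P by (intro node_mono) auto
        with j s show False by (auto simp: y_def)
      qed
      define p where "p = node a b P j"
      have p: "node a b P (j - 1) = p - h" "node a b P (j + 1) = p + h"
        using node_Suc[of a b P j] node_pred[of j a b P] j by (auto simp: p_def h_def)
      have dy: "?d y = u p - u (p - h)"
        using backward_diff_on_cell[OF ab j, of u] p by (simp add: p_def)
      have dyh: "?d (y + h) = u (p + h) - u p"
        using backward_diff_on_cell[OF ab, of "j + 1" P "y + h" u] j p \<open>j \<le> n\<close> n
        by (auto simp: p_def)
      have "\<bar>(u (p + h) - u p) - (u p - u (p - h)) - h\<^sup>2 * u2 y\<bar> \<le> 2 * M3 * h ^ 3"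
        by (rule second_difference_estimate[OF u u1 u2 M3 h])
          (use j p p_def \<open>j \<le> n\<close> n node_in_interval[OF ab P, of "j + 1"]
            node_in_interval[OF ab P, of "j - 1"] in auto)
      then show "\<bar>?d (x + h - s) - ?d (x - s) - h\<^sup>2 * u2 (x - s)\<bar> \<le> 2 * M3 * h ^ 3"
        using dy dyh by (simp add: y_def algebra_simps)
    qed (use x in auto)
    also have "\<dots> \<le> (2 * M3 * h ^ 3) * integral {0..b - a} (frac_kernel \<mu>)"
      using x M3_0 h by (intro mult_left_mono frac_kernel_integral_mono \<mu>) auto
    finally show ?thesis
      using integral_unique[OF *] by simp
  qed

  moreover have "\<bar>(u (a + h) - u a) * w - h\<^sup>2 * (u1 a * frac_kernel \<mu> (x - a))\<bar>
      \<le> (M1 * K + M2 * frac_kernel \<mu> \<epsilon>) * h ^ 3"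
  proof -
    define k where "k = frac_kernel \<mu> (x - a)"
    have k: "0 \<le> k" "k \<le> frac_kernel \<mu> \<epsilon>"
      unfolding k_def using frac_kernel_nonneg frac_kernel_antimono \<mu> \<epsilon> x\<epsilon> by auto
    have "\<bar>w - k * h\<bar> \<le> K * h * h"
    proof -
      have "continuous_on {x - a..x + h - a} (frac_kernel \<mu>)"
        using x\<epsilon> \<epsilon> by (intro DERIV_continuous_on[OF frac_kernel_has_derivative]) auto
      then have "((\<lambda>s. frac_kernel \<mu> s - k) has_integral w - k * h) {x - a..x + h - a}"
        unfolding w_def using h has_integral_const_real[of k "x - a" "x + h - a"]
        by (intro has_integral_diff integrable_integral integrable_continuous_real) (auto simp: mult.commute)
      then have "norm (w - k * h) \<le> (K * h) * Henstock_Kurzweil_Integration.content (cbox (x - a) (x + h - a))"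
      proof (intro Henstock_Kurzweil_Integration.has_integral_bound)
        fix s assume "s \<in> cbox (x - a) (x + h - a)"
        then have s: "x - a \<le> s" "s \<le> x - a + h" by auto
        have "\<bar>frac_kernel \<mu> s - k\<bar> \<le> K * \<bar>s - (x - a)\<bar>"
          unfolding k_def K_def using \<mu> \<epsilon> x\<epsilon> s by (intro frac_kernel_lipschitz_away_from_0) auto
        also have "\<dots> \<le> K * h"
          using s K0 by (intro mult_left_mono) auto
        finally show "norm (frac_kernel \<mu> s - k) \<le> K * h" by simp
      qed (use K0 h in auto)
      then show ?thesis using h by simp
    qed
    moreover have "\<bar>u (a + h) - u a\<bar> \<le> M1 * h"
      using derivative_bound_lipschitz[OF u M1, of "a + h" a] h x xh by auto
    ultimately have "\<bar>u (a + h) - u a\<bar> * \<bar>w - k * h\<bar> \<le> (M1 * h) * (K * h * h)"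
      using M1_0 h by (intro mult_mono) auto
    moreover have "\<bar>u (a + h) - u a - h * u1 a\<bar> * (k * h) \<le> (M2 * h\<^sup>2) * (frac_kernel \<mu> \<epsilon> * h)"
    proof (intro mult_mono)
      show "\<bar>u (a + h) - u a - h * u1 a\<bar> \<le> M2 * h\<^sup>2"
        by (rule first_difference_estimate[OF u u1 M2 h]) (use h x xh in auto)
      then show "0 \<le> M2 * h\<^sup>2" by (rule order_trans[OF abs_ge_zero])
    qed (use k h in auto)
    moreover have "(u (a + h) - u a) * w - h\<^sup>2 * (u1 a * k)
        = (u (a + h) - u a) * (w - k * h) + (u (a + h) - u a - h * u1 a) * (k * h)"
      by (simp add: algebra_simps power2_eq_square)
    moreover have "\<bar>(u (a + h) - u a - h * u1 a) * (k * h)\<bar> = \<bar>u (a + h) - u a - h * u1 a\<bar> * (k * h)"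
      using k h by (simp add: abs_mult)
    moreover have "(M1 * h) * (K * h * h) + (M2 * h\<^sup>2) * (frac_kernel \<mu> \<epsilon> * h)
        = (M1 * K + M2 * frac_kernel \<mu> \<epsilon>) * h ^ 3"
      by (simp add: algebra_simps power2_eq_square power3_eq_cube)
    ultimately show ?thesis
      unfolding k_def[symmetric]
      using abs_triangle_ineq[of "(u (a + h) - u a) * (w - k * h)" "(u (a + h) - u a - h * u1 a) * (k * h)"]
        abs_mult[of "u (a + h) - u a" "w - k * h"]
      by linarith
  qed
  moreover have "2 * M3 * h ^ 3 * integral {0..b - a} (frac_kernel \<mu>) + (M1 * K + M2 * frac_kernel \<mu> \<epsilon>) * h ^ 3
      = (2 * M3 * integral {0..b - a} (frac_kernel \<mu>) + M1 * K + M2 * frac_kernel \<mu> \<epsilon>) * h ^ 3"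
    by (simp add: algebra_simps)
  ultimately show ?thesis
    unfolding incr K_def[symmetric]
    by (smt (verit) distrib_left)
qed

section \<open>Truncation error of the flux difference\<close>

text \<open>
  A discrete product rule: \<open>kp * p - km * q = kp * (p - q) + (kp - km) * q\<close>, term by term close to
  \<open>h\<^sup>2 * (k * g' + k' * g)\<close>.
\<close>
lemma product_difference_estimate:
  fixes h :: real
  assumes h: "0 \<le> h"
    and k: "\<bar>kp\<bar> \<le> K0" "\<bar>kp - k\<bar> \<le> K1 * h" "\<bar>kp - km\<bar> \<le> K1 * h" "\<bar>kp - km - h * k'\<bar> \<le> K2 * h\<^sup>2"
    and g: "\<bar>g\<bar> \<le> G" "\<bar>g'\<bar> \<le> G'" "\<bar>q - h * g\<bar> \<le> C * h\<^sup>2" "\<bar>p - q - h\<^sup>2 * g'\<bar> \<le> D * h ^ 3"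
  shows "\<bar>kp * p - km * q - h\<^sup>2 * (k' * g + k * g')\<bar> \<le> (K0 * D + K1 * G' + K1 * C + K2 * G) * h ^ 3"
proof -
  have "\<bar>kp\<bar> * \<bar>p - q - h\<^sup>2 * g'\<bar> \<le> K0 * (D * h ^ 3)"
    using k g by (intro mult_mono) auto
  moreover have "\<bar>kp - k\<bar> * (h\<^sup>2 * \<bar>g'\<bar>) \<le> (K1 * h) * (h\<^sup>2 * G')"
    using k g by (intro mult_mono mult_left_mono) auto
  moreover have "\<bar>kp - km\<bar> * \<bar>q - h * g\<bar> \<le> (K1 * h) * (C * h\<^sup>2)"
    using k g by (intro mult_mono) auto
  moreover have "\<bar>kp - km - h * k'\<bar> * (h * \<bar>g\<bar>) \<le> (K2 * h\<^sup>2) * (h * G)"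
    using k g h by (intro mult_mono mult_left_mono) auto
  moreover have "kp * p - km * q - h\<^sup>2 * (k' * g + k * g')
      = kp * (p - q - h\<^sup>2 * g') + (kp - k) * (h\<^sup>2 * g') + (kp - km) * (q - h * g)
        + (kp - km - h * k') * (h * g)"
    by (simp add: algebra_simps power2_eq_square)
  then have "\<bar>kp * p - km * q - h\<^sup>2 * (k' * g + k * g')\<bar>
      \<le> \<bar>kp * (p - q - h\<^sup>2 * g')\<bar> + \<bar>(kp - k) * (h\<^sup>2 * g')\<bar> + \<bar>(kp - km) * (q - h * g)\<bar>
        + \<bar>(kp - km - h * k') * (h * g)\<bar>"
    by linarith
  then have "\<bar>kp * p - km * q - h\<^sup>2 * (k' * g + k * g')\<bar>
      \<le> \<bar>kp\<bar> * \<bar>p - q - h\<^sup>2 * g'\<bar> + \<bar>kp - k\<bar> * (h\<^sup>2 * \<bar>g'\<bar>) + \<bar>kp - km\<bar> * \<bar>q - h * g\<bar>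
        + \<bar>kp - km - h * k'\<bar> * (h * \<bar>g\<bar>)"
    using h by (simp only: abs_mult abs_power2 abs_of_nonneg)
  ultimately have "\<bar>kp * p - km * q - h\<^sup>2 * (k' * g + k * g')\<bar>
      \<le> K0 * (D * h ^ 3) + (K1 * h) * (h\<^sup>2 * G') + (K1 * h) * (C * h\<^sup>2) + (K2 * h\<^sup>2) * (h * G)"
    by linarith
  also have "\<dots> = (K0 * D + K1 * G' + K1 * C + K2 * G) * h ^ 3"
    by (simp add: algebra_simps power2_eq_square power3_eq_cube)
  finally show ?thesis .
qed

lemma left_flux_truncation:
  fixes u u1 u2 u3 \<kappa> \<kappa>1 \<kappa>2 :: "real \<Rightarrow> real"
  assumes \<mu>: "0 < \<mu>" "\<mu> \<le> 1" and ab: "a < b" and \<epsilon>: "0 < \<epsilon>"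
    and u: "\<And>y. y \<in> {a..b} \<Longrightarrow> (u has_real_derivative u1 y) (at y within {a..b})"
    and u1: "\<And>y. y \<in> {a..b} \<Longrightarrow> (u1 has_real_derivative u2 y) (at y within {a..b})"
    and u2: "\<And>y. y \<in> {a..b} \<Longrightarrow> (u2 has_real_derivative u3 y) (at y within {a..b})"
    and u3: "continuous_on {a..b} u3"
    and \<kappa>: "\<And>y. y \<in> {a..b} \<Longrightarrow> (\<kappa> has_real_derivative \<kappa>1 y) (at y within {a..b})"
    and \<kappa>1: "\<And>y. y \<in> {a..b} \<Longrightarrow> (\<kappa>1 has_real_derivative \<kappa>2 y) (at y within {a..b})"
    and \<kappa>2: "continuous_on {a..b} \<kappa>2"
  shows "\<exists>C. \<forall>P n. n \<in> {1..P - 1} \<longrightarrow> a + \<epsilon> \<le> node a b P n \<longrightarrow>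
    \<bar>\<kappa> (midpoint_node a b P n) * RL_int_left \<mu> a (backward_diff a b P u) (node a b P (n + 1))
      - \<kappa> (midpoint_node a b P (n - 1)) * RL_int_left \<mu> a (backward_diff a b P u) (node a b P n)
      - (mesh_size a b P)\<^sup>2 *
        (\<kappa>1 (node a b P n) * RL_int_left \<mu> a u1 (node a b P n)
          + \<kappa> (node a b P n) *
            (u1 a * frac_kernel \<mu> (node a b P n - a) + RL_int_left \<mu> a u2 (node a b P n)))\<bar>
    \<le> C * mesh_size a b P ^ 3"
proof -
  note cont = DERIV_continuous_on[OF u1] DERIV_continuous_on[OF u2] DERIV_continuous_on[OF \<kappa>]
    DERIV_continuous_on[OF \<kappa>1]
  obtain M1 where M1: "0 \<le> M1" "\<And>y. y \<in> {a..b} \<Longrightarrow> \<bar>u1 y\<bar> \<le> M1"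
    using continuous_on_Icc_bounded[OF cont(1)] by blast
  obtain M2 where M2: "0 \<le> M2" "\<And>y. y \<in> {a..b} \<Longrightarrow> \<bar>u2 y\<bar> \<le> M2"
    using continuous_on_Icc_bounded[OF cont(2)] by blast
  obtain M3 where M3: "0 \<le> M3" "\<And>y. y \<in> {a..b} \<Longrightarrow> \<bar>u3 y\<bar> \<le> M3"
    using continuous_on_Icc_bounded[OF u3] by blast
  obtain K0 where K0: "0 \<le> K0" "\<And>y. y \<in> {a..b} \<Longrightarrow> \<bar>\<kappa> y\<bar> \<le> K0"
    using continuous_on_Icc_bounded[OF cont(3)] by blast
  obtain K1 where K1: "0 \<le> K1" "\<And>y. y \<in> {a..b} \<Longrightarrow> \<bar>\<kappa>1 y\<bar> \<le> K1"
    using continuous_on_Icc_bounded[OF cont(4)] by blast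
  obtain K2 where K2: "0 \<le> K2" "\<And>y. y \<in> {a..b} \<Longrightarrow> \<bar>\<kappa>2 y\<bar> \<le> K2"
    using continuous_on_Icc_bounded[OF \<kappa>2] by blast
  define W where "W = integral {0..b - a} (frac_kernel \<mu>)"
  define D where "D = 2 * M3 * W + M1 * ((1 - \<mu>) * \<epsilon> powr (\<mu> - 2) / Gamma \<mu>) + M2 * frac_kernel \<mu> \<epsilon>"
  define G' where "G' = M1 * frac_kernel \<mu> \<epsilon> + M2 * W"
  show ?thesis
  proof (intro exI[of _ "K0 * D + K1 * G' + K1 * (M2 * W) + K2 * (M1 * W)"] allI impI)
    fix P n assume n: "n \<in> {1..P - 1}" and x\<epsilon>: "a + \<epsilon> \<le> node a b P n"
    define x h where "x = node a b P n" and "h = mesh_size a b P"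
    have P: "0 < P" "n < P" using n by auto
    have h: "0 < h" using mesh_size_pos[OF ab P(1)] by (simp add: h_def)
    have x: "a \<le> x - h" "x + h \<le> b"
      using node_in_interval[OF ab P(1), of "n - 1"] node_in_interval[OF ab P(1), of "n + 1"] n P
        node_pred[of n a b P] node_Suc[of a b P n] by (auto simp: x_def h_def)
    have mid: "midpoint_node a b P n = x + h / 2" "midpoint_node a b P (n - 1) = x - h / 2"
      using node_pred[of n a b P] n by (auto simp: midpoint_node_eq x_def h_def)
    have \<kappa>_lip: "\<bar>\<kappa> y - \<kappa> z\<bar> \<le> K1 * h" if "y \<in> {a..b}" "z \<in> {a..b}" "\<bar>y - z\<bar> \<le> h" for y z
      using order_trans[OF derivative_bound_lipschitz[OF \<kappa> K1(2) that(1,2)] mult_left_mono[OF that(3) K1(1)]] .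
    have "\<bar>\<kappa> (x + h / 2) * RL_int_left \<mu> a (backward_diff a b P u) (x + h)
        - \<kappa> (x - h / 2) * RL_int_left \<mu> a (backward_diff a b P u) x
        - h\<^sup>2 * (\<kappa>1 x * RL_int_left \<mu> a u1 x
            + \<kappa> x * (u1 a * frac_kernel \<mu> (x - a) + RL_int_left \<mu> a u2 x))\<bar>
      \<le> (K0 * D + K1 * G' + K1 * (M2 * W) + K2 * (M1 * W)) * h ^ 3"
    proof (rule product_difference_estimate)
      show "\<bar>\<kappa> (x + h / 2)\<bar> \<le> K0"
        using K0 x h by auto
      show "\<bar>\<kappa> (x + h / 2) - \<kappa> x\<bar> \<le> K1 * h" "\<bar>\<kappa> (x + h / 2) - \<kappa> (x - h / 2)\<bar> \<le> K1 * h"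
        using x h by (auto intro!: \<kappa>_lip)
      have "\<bar>\<kappa> (x - h / 2 + h) - \<kappa> (x - h / 2) - h * \<kappa>1 x\<bar> \<le> K2 * h\<^sup>2"
        by (rule first_difference_estimate[OF \<kappa> \<kappa>1 K2(2) h]) (use x h in auto)
      moreover have "x - h / 2 + h = x + h / 2" by (simp add: field_simps)
      ultimately show "\<bar>\<kappa> (x + h / 2) - \<kappa> (x - h / 2) - h * \<kappa>1 x\<bar> \<le> K2 * h\<^sup>2"
        by (simp only:)
      show "\<bar>RL_int_left \<mu> a u1 x\<bar> \<le> M1 * W"
        unfolding W_def by (rule RL_int_left_bound[OF \<mu>(1) _ cont(1) M1(2)]) (use x h in auto)
      have "\<bar>RL_int_left \<mu> a u2 x\<bar> \<le> M2 * W"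
        unfolding W_def by (rule RL_int_left_bound[OF \<mu>(1) _ cont(2) M2(2)]) (use x h in auto)
      moreover have "\<bar>u1 a\<bar> * \<bar>frac_kernel \<mu> (x - a)\<bar> \<le> M1 * frac_kernel \<mu> \<epsilon>"
      proof (intro mult_mono)
        show "\<bar>u1 a\<bar> \<le> M1" using M1 ab by auto
        show "\<bar>frac_kernel \<mu> (x - a)\<bar> \<le> frac_kernel \<mu> \<epsilon>"
          using frac_kernel_nonneg[OF \<mu>(1)] frac_kernel_antimono[OF \<mu> \<epsilon>, of "x - a"] x\<epsilon>
          by (simp add: x_def)
      qed (use M1 in auto)
      ultimately show "\<bar>u1 a * frac_kernel \<mu> (x - a) + RL_int_left \<mu> a u2 x\<bar> \<le> G'"
        unfolding G'_def abs_mult[symmetric] by linarith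
      show "\<bar>RL_int_left \<mu> a (backward_diff a b P u) x - h * RL_int_left \<mu> a u1 x\<bar> \<le> M2 * W * h\<^sup>2"
        unfolding x_def h_def W_def using P
        by (intro RL_int_backward_diff_estimate[OF \<mu>(1) ab u u1 M2(2)]) auto
      show "\<bar>RL_int_left \<mu> a (backward_diff a b P u) (x + h) - RL_int_left \<mu> a (backward_diff a b P u) x
          - h\<^sup>2 * (u1 a * frac_kernel \<mu> (x - a) + RL_int_left \<mu> a u2 x)\<bar> \<le> D * h ^ 3"
        unfolding x_def h_def W_def D_def using x\<epsilon> P
        by (intro RL_int_backward_diff_increment_estimate[OF \<mu> ab \<epsilon> u u1 u2 M1(2) M2(2) M3(2)]) auto
    qed (use h in auto)
    then show "\<bar>\<kappa> (midpoint_node a b P n) * RL_int_left \<mu> a (backward_diff a b P u) (node a b P (n + 1))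
      - \<kappa> (midpoint_node a b P (n - 1)) * RL_int_left \<mu> a (backward_diff a b P u) (node a b P n)
      - (mesh_size a b P)\<^sup>2 *
        (\<kappa>1 (node a b P n) * RL_int_left \<mu> a u1 (node a b P n)
          + \<kappa> (node a b P n) *
            (u1 a * frac_kernel \<mu> (node a b P n - a) + RL_int_left \<mu> a u2 (node a b P n)))\<bar>
      \<le> (K0 * D + K1 * G' + K1 * (M2 * W) + K2 * (M1 * W)) * mesh_size a b P ^ 3"
      by (simp only: mid x_def h_def node_Suc Suc_eq_plus1[symmetric])
  qed
qed

text \<open>
  Reflection sends \<open>x\<^sub>n\<close> to \<open>x\<^sub>P\<^sub>-\<^sub>n\<close> and exchanges the two half-points. It changes the sign of
  \<open>\<delta>u\<close>, so the right-sided flux difference at \<open>x\<^sub>n\<close> is exactly the left-sided one of the reflected data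
  at \<open>x\<^sub>P\<^sub>-\<^sub>n\<close>.
\<close>
lemma right_flux_truncation:
  fixes u u1 u2 u3 \<kappa> \<kappa>1 \<kappa>2 :: "real \<Rightarrow> real"
  assumes \<mu>: "0 < \<mu>" "\<mu> \<le> 1" and ab: "a < b" and \<epsilon>: "0 < \<epsilon>"
    and u: "\<And>y. y \<in> {a..b} \<Longrightarrow> (u has_real_derivative u1 y) (at y within {a..b})"
    and u1: "\<And>y. y \<in> {a..b} \<Longrightarrow> (u1 has_real_derivative u2 y) (at y within {a..b})"
    and u2: "\<And>y. y \<in> {a..b} \<Longrightarrow> (u2 has_real_derivative u3 y) (at y within {a..b})"
    and u3: "continuous_on {a..b} u3"
    and \<kappa>: "\<And>y. y \<in> {a..b} \<Longrightarrow> (\<kappa> has_real_derivative \<kappa>1 y) (at y within {a..b})"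
    and \<kappa>1: "\<And>y. y \<in> {a..b} \<Longrightarrow> (\<kappa>1 has_real_derivative \<kappa>2 y) (at y within {a..b})"
    and \<kappa>2: "continuous_on {a..b} \<kappa>2"
  shows "\<exists>C. \<forall>P n. n \<in> {1..P - 1} \<longrightarrow> node a b P n \<le> b - \<epsilon> \<longrightarrow>
    \<bar>\<kappa> (midpoint_node a b P n) * RL_int_right \<mu> b (backward_diff a b P u) (node a b P n)
      - \<kappa> (midpoint_node a b P (n - 1)) * RL_int_right \<mu> b (backward_diff a b P u) (node a b P (n - 1))
      - (mesh_size a b P)\<^sup>2 *
        (\<kappa>1 (node a b P n) * RL_int_right \<mu> b u1 (node a b P n)
          + \<kappa> (node a b P n) *
            (- u1 b * frac_kernel \<mu> (b - node a b P n) + RL_int_right \<mu> b u2 (node a b P n)))\<bar>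
    \<le> C * mesh_size a b P ^ 3"
proof -
  define r where "r = (\<lambda>y. a + b - y)"
  have r: "r y \<in> {a..b}" if "y \<in> {a..b}" for y
    using that by (auto simp: r_def)
  have reflect: "((\<lambda>y. v (r y)) has_real_derivative - v' (r y)) (at y within {a..b})"
    if "\<And>y. y \<in> {a..b} \<Longrightarrow> (v has_real_derivative v' y) (at y within {a..b})" "y \<in> {a..b}" for v v' y
    using has_derivative_reflect[of v "v' (r y)" a b y] that r unfolding r_def by auto
  have reflect_neg: "((\<lambda>y. - v (r y)) has_real_derivative v' (r y)) (at y within {a..b})"
    if "\<And>y. y \<in> {a..b} \<Longrightarrow> (v has_real_derivative v' y) (at y within {a..b})" "y \<in> {a..b}" for v v' y
    using DERIV_minus[OF reflect[of v v', OF that]] by simp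
  have cont: "continuous_on {a..b} (\<lambda>y. - u3 (r y))" "continuous_on {a..b} (\<lambda>y. \<kappa>2 (r y))"
    unfolding r_def by (intro continuous_on_minus continuous_on_reflect u3 \<kappa>2)+
  obtain C where C: "\<And>P m. m \<in> {1..P - 1} \<Longrightarrow> a + \<epsilon> \<le> node a b P m \<Longrightarrow>
    \<bar>\<kappa> (r (midpoint_node a b P m)) * RL_int_left \<mu> a (backward_diff a b P (\<lambda>y. u (r y))) (node a b P (m + 1))
      - \<kappa> (r (midpoint_node a b P (m - 1))) * RL_int_left \<mu> a (backward_diff a b P (\<lambda>y. u (r y))) (node a b P m)
      - (mesh_size a b P)\<^sup>2 *
        (- \<kappa>1 (r (node a b P m)) * RL_int_left \<mu> a (\<lambda>y. - u1 (r y)) (node a b P m)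
          + \<kappa> (r (node a b P m)) *
            (- u1 (r a) * frac_kernel \<mu> (node a b P m - a)
              + RL_int_left \<mu> a (\<lambda>y. u2 (r y)) (node a b P m)))\<bar>
    \<le> C * mesh_size a b P ^ 3"
    using left_flux_truncation[OF \<mu> ab \<epsilon> reflect[OF u] reflect_neg[OF u1] reflect[OF u2] cont(1)
        reflect[OF \<kappa>] reflect_neg[OF \<kappa>1] cont(2)] by blast
  show ?thesis
  proof (intro exI[of _ C] allI impI)
    fix P n assume n: "n \<in> {1..P - 1}" and xb: "node a b P n \<le> b - \<epsilon>"
    define m where "m = P - n"
    have P: "0 < P" and m: "m \<in> {1..P - 1}"
      using n by (auto simp: m_def)
    have idx: "m + 1 = P - (n - 1)" "m - 1 = P - (n + 1)"
      using n by (auto simp: m_def)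
    have nodes: "node a b P m = r (node a b P n)" "node a b P (m + 1) = r (node a b P (n - 1))"
      "node a b P (m - 1) = r (node a b P (n + 1))"
      unfolding idx unfolding m_def r_def using n by - (rule node_reflect[OF P], (auto)[1])+
    have mids: "midpoint_node a b P m = r (midpoint_node a b P (n - 1))"
      "midpoint_node a b P (m - 1) = r (midpoint_node a b P n)"
      using nodes m n by (auto simp: midpoint_node_def r_def field_simps)
    have RL: "RL_int_right \<mu> b v y = RL_int_left \<mu> a (\<lambda>z. v (r z)) (r y)" for v y
      unfolding r_def by (rule RL_int_right_reflect)
    have RL_diff: "RL_int_right \<mu> b (backward_diff a b P u) y
        = - RL_int_left \<mu> a (backward_diff a b P (\<lambda>z. u (r z))) (r y)" for y
      unfolding RL r_def by (simp add: backward_diff_reflect[OF P] RL_int_left_uminus)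
    have rr: "r (r y) = y" "r a = b" "r y - a = b - y" for y
      by (auto simp: r_def)
    have "a + \<epsilon> \<le> node a b P m"
      using xb by (simp add: nodes r_def)
    from C[OF m this, unfolded nodes mids rr RL_int_left_uminus] show "\<bar>\<kappa> (midpoint_node a b P n) * RL_int_right \<mu> b (backward_diff a b P u) (node a b P n)
      - \<kappa> (midpoint_node a b P (n - 1)) * RL_int_right \<mu> b (backward_diff a b P u) (node a b P (n - 1))
      - (mesh_size a b P)\<^sup>2 *
        (\<kappa>1 (node a b P n) * RL_int_right \<mu> b u1 (node a b P n)
          + \<kappa> (node a b P n) *
            (- u1 b * frac_kernel \<mu> (b - node a b P n) + RL_int_right \<mu> b u2 (node a b P n)))\<bar>
      \<le> C * mesh_size a b P ^ 3"
      unfolding RL_diff by (simp add: RL algebra_simps)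
  qed
qed

section \<open>The truncation error away from the boundary\<close>

lemma Ck_on_Suc_derivative:
  assumes "Ck_on (Suc k) S v"
  obtains v' where "\<And>x. x \<in> S \<Longrightarrow> (v has_real_derivative v' x) (at x within S)" "Ck_on k S v'"
proof -
  obtain D where D: "\<forall>x\<in>S. D 0 x = v x"
    "\<forall>j<Suc k. \<forall>x\<in>S. (D j has_real_derivative D (Suc j) x) (at x within S)"
    "\<forall>j\<le>Suc k. continuous_on S (D j)"
    using assms unfolding Ck_on_def by blast
  show thesis
  proof (rule that[of "D 1"])
    show "(v has_real_derivative D 1 x) (at x within S)" if "x \<in> S" for x
      unfolding has_field_derivative_def
    proof (rule has_derivative_transform[OF that])
      show "(D 0 has_derivative (*) (D 1 x)) (at x within S)"
        using D(2)[rule_format, of 0 x] that by (simp add: has_field_derivative_def)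
    qed (use D(1) in auto)
    show "Ck_on k S (D 1)"
      unfolding Ck_on_def using D by (intro exI[of _ "\<lambda>j. D (Suc j)"]) auto
  qed
qed

lemma Ck_on_0_continuous: "Ck_on 0 S v \<Longrightarrow> continuous_on S v"
  unfolding Ck_on_def by (metis bot_nat_0.extremum continuous_on_cong)

text \<open>
  The boundary values \<open>u a = u b = 0\<close> remove the singular terms of \<open>\<partial>\<^sub>x\<^sup>\<alpha>\<^sup>,\<^sup>\<theta> u\<close>, which becomes a
  combination of fractional integrals of \<open>u1\<close>.
\<close>
lemma frac_deriv_eq_RL_int:
  assumes "\<alpha> < 1" "x \<in> {a<..<b}"
    and "\<And>y. y \<in> {a..b} \<Longrightarrow> (u has_real_derivative u1 y) (at y within {a..b})"
    and "continuous_on {a..b} u1" "u a = 0" "u b = 0"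
  shows "frac_deriv \<alpha> \<theta> a b u x
    = \<theta> * RL_int_left (1 - \<alpha>) a u1 x + (1 - \<theta>) * RL_int_right (1 - \<alpha>) b u1 x"
  using DERIV_imp_deriv[OF RL_int_left_has_derivative[of "1 - \<alpha>" x a b u u1]]
    DERIV_imp_deriv[OF RL_int_right_has_derivative[of "1 - \<alpha>" x a b u u1]] assms
  by (simp add: frac_deriv_def RL_deriv_left_def RL_deriv_right_def)

theorem mainTheorem6:
  fixes a b \<alpha> \<theta> c0 c1 :: real and \<kappa> u f :: "real \<Rightarrow> real"
  assumes "a < b"
    and "0 < \<alpha>" and "\<alpha> < 1"
    and "0 \<le> \<theta>" and "\<theta> \<le> 1"
    and "0 < c0" and "0 < c1"
    and "\<And>x. x \<in> {a<..<b} \<Longrightarrow> c0 \<le> \<kappa> x \<and> \<kappa> x \<le> c1"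
    and "\<And>x. x \<in> {a<..<b} \<Longrightarrow>
           (\<lambda>y. \<kappa> y * frac_deriv \<alpha> \<theta> a b u y) differentiable (at x) \<and>
           - deriv (\<lambda>y. \<kappa> y * frac_deriv \<alpha> \<theta> a b u y) x = f x"
    and "u a = 0" and "u b = 0"
    and "Ck_on 1 {a..b} f"
    and "Ck_on 2 {a..b} \<kappa>"
    and "Ck_on 3 {a..b} u"
  shows "\<forall>\<epsilon>>0. \<exists>C. \<forall>P\<ge>2. \<forall>n\<in>{1..P - 1}.
           a + \<epsilon> \<le> node a b P n \<and> node a b P n \<le> b - \<epsilon> \<longrightarrow>
           \<bar>truncation_error \<alpha> \<theta> a b \<kappa> u P n\<bar> \<le> C * mesh_size a b P"
proof (intro allI impI)
  fix \<epsilon> :: real assume \<epsilon>: "0 < \<epsilon>"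
  have "Ck_on (Suc (Suc (Suc 0))) {a..b} u" "Ck_on (Suc (Suc 0)) {a..b} \<kappa>"
    using assms(13,14) by (simp_all add: numeral_eq_Suc)
  then obtain u1 u2 u3 \<kappa>1 \<kappa>2 where
      u: "\<And>y. y \<in> {a..b} \<Longrightarrow> (u has_real_derivative u1 y) (at y within {a..b})"
    and u1: "\<And>y. y \<in> {a..b} \<Longrightarrow> (u1 has_real_derivative u2 y) (at y within {a..b})"
    and u2: "\<And>y. y \<in> {a..b} \<Longrightarrow> (u2 has_real_derivative u3 y) (at y within {a..b})"
    and u3: "continuous_on {a..b} u3"
    and \<kappa>: "\<And>y. y \<in> {a..b} \<Longrightarrow> (\<kappa> has_real_derivative \<kappa>1 y) (at y within {a..b})"
    and \<kappa>1: "\<And>y. y \<in> {a..b} \<Longrightarrow> (\<kappa>1 has_real_derivative \<kappa>2 y) (at y within {a..b})"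
    and \<kappa>2: "continuous_on {a..b} \<kappa>2"
    by (metis Ck_on_Suc_derivative Ck_on_0_continuous)
  have cont_u1: "continuous_on {a..b} u1" and cont_u2: "continuous_on {a..b} u2"
    using DERIV_continuous_on[OF u1] DERIV_continuous_on[OF u2] by auto
  define \<mu> where "\<mu> = 1 - \<alpha>"
  have \<mu>: "0 < \<mu>" "\<mu> \<le> 1" using assms by (auto simp: \<mu>_def)
  have frac: "frac_deriv \<alpha> \<theta> a b u y = \<theta> * RL_int_left \<mu> a u1 y + (1 - \<theta>) * RL_int_right \<mu> b u1 y"
    if "y \<in> {a<..<b}" for y
    unfolding \<mu>_def by (rule frac_deriv_eq_RL_int[OF assms(3) that u cont_u1 assms(10,11)])
  define EL where "EL = (\<lambda>x. \<kappa>1 x * RL_int_left \<mu> a u1 x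
      + \<kappa> x * (u1 a * frac_kernel \<mu> (x - a) + RL_int_left \<mu> a u2 x))"
  define ER where "ER = (\<lambda>x. \<kappa>1 x * RL_int_right \<mu> b u1 x
      + \<kappa> x * (- u1 b * frac_kernel \<mu> (b - x) + RL_int_right \<mu> b u2 x))"
  have flux_deriv: "deriv (\<lambda>y. \<kappa> y * frac_deriv \<alpha> \<theta> a b u y) x = \<theta> * EL x + (1 - \<theta>) * ER x"
    if x: "x \<in> {a<..<b}" for x
  proof (rule DERIV_imp_deriv)
    have "(\<kappa> has_real_derivative \<kappa>1 x) (at x)"
      using \<kappa>[of x] x at_within_Icc_at[of a x b] by auto
    from DERIV_mult[OF this DERIV_add[OF DERIV_cmult[OF RL_int_left_has_derivative[OF \<mu>(1) x u1 cont_u2], of \<theta>]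
          DERIV_cmult[OF RL_int_right_has_derivative[OF \<mu>(1) x u1 cont_u2], of "1 - \<theta>"]]]
    have "((\<lambda>y. \<kappa> y * (\<theta> * RL_int_left \<mu> a u1 y + (1 - \<theta>) * RL_int_right \<mu> b u1 y))
        has_real_derivative \<theta> * EL x + (1 - \<theta>) * ER x) (at x)"
      by (simp add: EL_def ER_def algebra_simps)
    then show "((\<lambda>y. \<kappa> y * frac_deriv \<alpha> \<theta> a b u y) has_real_derivative \<theta> * EL x + (1 - \<theta>) * ER x) (at x)"
      by (rule has_field_derivative_transform_within_open[where S = "{a<..<b}"])
        (use x frac in auto)
  qed
  obtain CL where CL: "\<And>P n. n \<in> {1..P - 1} \<Longrightarrow> a + \<epsilon> \<le> node a b P n \<Longrightarrow>
      \<bar>\<kappa> (midpoint_node a b P n) * RL_int_left \<mu> a (backward_diff a b P u) (node a b P (n + 1))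
        - \<kappa> (midpoint_node a b P (n - 1)) * RL_int_left \<mu> a (backward_diff a b P u) (node a b P n)
        - (mesh_size a b P)\<^sup>2 * EL (node a b P n)\<bar> \<le> CL * mesh_size a b P ^ 3"
    using left_flux_truncation[OF \<mu> assms(1) \<epsilon> u u1 u2 u3 \<kappa> \<kappa>1 \<kappa>2] unfolding EL_def by blast
  obtain CR where CR: "\<And>P n. n \<in> {1..P - 1} \<Longrightarrow> node a b P n \<le> b - \<epsilon> \<Longrightarrow>
      \<bar>\<kappa> (midpoint_node a b P n) * RL_int_right \<mu> b (backward_diff a b P u) (node a b P n)
        - \<kappa> (midpoint_node a b P (n - 1)) * RL_int_right \<mu> b (backward_diff a b P u) (node a b P (n - 1))
        - (mesh_size a b P)\<^sup>2 * ER (node a b P n)\<bar> \<le> CR * mesh_size a b P ^ 3"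
    using right_flux_truncation[OF \<mu> assms(1) \<epsilon> u u1 u2 u3 \<kappa> \<kappa>1 \<kappa>2] unfolding ER_def by blast
  show "\<exists>C. \<forall>P\<ge>2. \<forall>n\<in>{1..P - 1}.
           a + \<epsilon> \<le> node a b P n \<and> node a b P n \<le> b - \<epsilon> \<longrightarrow>
           \<bar>truncation_error \<alpha> \<theta> a b \<kappa> u P n\<bar> \<le> C * mesh_size a b P"
  proof (intro exI[of _ "\<theta> * CL + (1 - \<theta>) * CR"] allI impI ballI, elim conjE)
    fix P n :: nat
    assume P: "2 \<le> P" and n: "n \<in> {1..P - 1}"
      and xa: "a + \<epsilon> \<le> node a b P n" and xb: "node a b P n \<le> b - \<epsilon>"
    define x h where "x = node a b P n" and "h = mesh_size a b P"
    have h: "0 < h" using mesh_size_pos[OF assms(1)] P by (simp add: h_def)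
    have x: "x \<in> {a<..<b}" using xa xb \<epsilon> by (simp add: x_def)
    define L where "L = \<kappa> (midpoint_node a b P n) * RL_int_left \<mu> a (backward_diff a b P u) (node a b P (n + 1))
        - \<kappa> (midpoint_node a b P (n - 1)) * RL_int_left \<mu> a (backward_diff a b P u) (node a b P n)
        - h\<^sup>2 * EL x"
    define R where "R = \<kappa> (midpoint_node a b P n) * RL_int_right \<mu> b (backward_diff a b P u) (node a b P n)
        - \<kappa> (midpoint_node a b P (n - 1)) * RL_int_right \<mu> b (backward_diff a b P u) (node a b P (n - 1))
        - h\<^sup>2 * ER x"
    have "truncation_error \<alpha> \<theta> a b \<kappa> u P n = - (\<theta> * L + (1 - \<theta>) * R) / h\<^sup>2"
      unfolding truncation_error_def \<mu>_def[symmetric] x_def[symmetric] h_def[symmetric] flux_deriv[OF x]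
      using h by (simp add: L_def R_def x_def field_simps)
    then have "\<bar>truncation_error \<alpha> \<theta> a b \<kappa> u P n\<bar> = \<bar>\<theta> * L + (1 - \<theta>) * R\<bar> / h\<^sup>2"
      by (simp only: abs_divide abs_minus_cancel abs_power2)
    also have "\<dots> \<le> ((\<theta> * CL + (1 - \<theta>) * CR) * h ^ 3) / h\<^sup>2"
    proof (rule divide_right_mono)
      have "\<bar>\<theta> * L\<bar> \<le> \<theta> * (CL * h ^ 3)"
        using mult_left_mono[OF CL[OF n xa] assms(4)] assms(4) by (simp add: abs_mult L_def x_def h_def)
      moreover have "\<bar>(1 - \<theta>) * R\<bar> \<le> (1 - \<theta>) * (CR * h ^ 3)"
        using mult_left_mono[OF CR[OF n xb], of "1 - \<theta>"] assms(5) by (simp add: abs_mult R_def x_def h_def)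
      ultimately have "\<bar>\<theta> * L + (1 - \<theta>) * R\<bar> \<le> \<theta> * (CL * h ^ 3) + (1 - \<theta>) * (CR * h ^ 3)"
        using abs_triangle_ineq[of "\<theta> * L" "(1 - \<theta>) * R"] by linarith
      then show "\<bar>\<theta> * L + (1 - \<theta>) * R\<bar> \<le> (\<theta> * CL + (1 - \<theta>) * CR) * h ^ 3"
        by (simp add: algebra_simps)
    qed simp
    also have "\<dots> = (\<theta> * CL + (1 - \<theta>) * CR) * mesh_size a b P"
      using h by (simp add: h_def power2_eq_square power3_eq_cube)
    finally show "\<bar>truncation_error \<alpha> \<theta> a b \<kappa> u P n\<bar> \<le> (\<theta> * CL + (1 - \<theta>) * CR) * mesh_size a b P" .
  qed
qed

end
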